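(* Let $T>0$, let $H_0$ be a positive self-adjoint operator on a complex separable Hilbert space $\mathcal{H}$, and let $\mathcal{H}^+\subset\mathcal{H}\subset\mathcal{H}^-$ be its associated scale of Hilbert spaces. For $0\le t\le T$ let $H(t)$ be a bounded operator from $\mathcal{H}^+$ to $\mathcal{H}^-$ such that $(\Psi,H(t)\Phi)=(H(t)\Psi,\Phi)$ for all $\Psi,\Phi\in\mathcal{H}^+$. Assume that there is $C>0$ independent of $t$ such that for all $t\in[0,T]$: (S1) $C^{-1}(H_0+1)\le H(t)\le C(H_0+1)$; (S2) $B(t)=\frac{\mathrm{d}}{\mathrm{d}t}H(t)^{-1}$ exists in the sense of the norm of $\mathcal{B}(\mathcal{H})$ and satisfies $\|H(t)^{1/2}B(t)H(t)^{1/2}\|\le C$. Assume moreover that $t\in[0,T]\mapsto B(t)\in\mathcal{B}(\mathcal{H})$ is continuous. Then $\langle\cdot,\cdot\rangle_{+,t}:=(\cdot,H(t)\cdot)$ defines a family of inner products on the dense subspace $\mathcal{H}^+$ of $\mathcal{H}$ such that: (K1) for every $t\in[0,T]$, $\langle\cdot,\cdot\rangle_{+,t}$ endows $\mathcal{H}^+$ with the structure of a Hilbert space continuously contained in $\mathcal{H}$; (K2) for every $\Psi,\Phi\in\mathcal{H}^+$, the function $t\mapsto\langle\Psi,\Phi\rangle_{+,t}$ is in $C^1([0,T])$.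
   Context: Inner products are antilinear in the first argument, linear in the second. Scale associated with $H_0$: $\mathcal{H}^+=\operatorname{dom}(H_0^{1/2})$ with norm $\|\Phi\|_+=\|(H_0+1)^{1/2}\Phi\|$; $\mathcal{H}^-$ is the completion of $\mathcal{H}$ in the norm $\|\Phi\|_-=\|(H_0+1)^{-1/2}\Phi\|$; the inner product of $\mathcal{H}$ extends continuously to a pairing $(\cdot,\cdot)$ on $\mathcal{H}^-\times\mathcal{H}^+\cup\mathcal{H}^+\times\mathcal{H}^-$, identifying $\mathcal{H}^-$ with the bounded antilinear functionals on $\mathcal{H}^+$; $H_0$ extends to a bounded operator $\mathcal{H}^+\to\mathcal{H}^-$. Inequalities in (S1) are in the sense of quadratic forms: $A\le A'$ means $(\Phi,A\Phi)\le(\Phi,A'\Phi)$ for all $\Phi\in\mathcal{H}^+$. Under (S1), $H(t):\mathcal{H}^+\to\mathcal{H}^-$ is a bijection and its restriction to $\{\Phi\in\mathcal{H}^+:H(t)\Phi\in\mathcal{H}\}$ is a strictly positive self-adjoint operator on $\mathcal{H}$ (denoted by the same symbol) with form domain $\mathcal{H}^+=\operatorname{dom}H(t)^{1/2}$; $H(t)^{-1}\in\mathcal{B}(\mathcal{H})$ is its inverse. The bound in (S2) means $|\langle H(t)^{1/2}\Psi,B(t)H(t)^{1/2}\Phi\rangle|\le C\|\Psi\|\|\Phi\|$ for all $\Psi,\Phi\in\mathcal{H}^+$. *)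

theory Defs
  imports "HOL-Analysis.Analysis"
begin

section \<open>Complex Hilbert spaces\<close>

text \<open>
  A complex Hilbert space is a real one with a compatible complex structure; \<open>inner\<close>, and hence
  \<open>norm\<close>, is the real part of \<open>cinner\<close>, so that \<open>norm x\<close> is the square root of \<open>cinner x x\<close>.
  The inner product is antilinear in the first argument.
\<close>

class complex_hilbert = real_inner + banach +
  fixes scaleC :: "complex \<Rightarrow> 'a \<Rightarrow> 'a" (infixr \<open>*\<^sub>C\<close> 75)
    and cinner :: "'a \<Rightarrow> 'a \<Rightarrow> complex"
  assumes scaleC_add_right: "a *\<^sub>C (x + y) = a *\<^sub>C x + a *\<^sub>C y"
    and scaleC_add_left: "(a + b) *\<^sub>C x = a *\<^sub>C x + b *\<^sub>C x"
    and scaleC_scaleC: "a *\<^sub>C b *\<^sub>C x = (a * b) *\<^sub>C x"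
    and scaleC_of_real: "complex_of_real r *\<^sub>C x = r *\<^sub>R x"
    and cinner_commute: "cinner x y = cnj (cinner y x)"
    and cinner_add_right: "cinner x (y + z) = cinner x y + cinner x z"
    and cinner_scaleC_right: "cinner x (a *\<^sub>C y) = a * cinner x y"
    and Re_cinner: "Re (cinner x y) = inner x y"

definition csubspace :: "'a::complex_hilbert set \<Rightarrow> bool" where
  "csubspace D \<longleftrightarrow>
     0 \<in> D \<and> (\<forall>x\<in>D. \<forall>y\<in>D. x + y \<in> D) \<and> (\<forall>a. \<forall>x\<in>D. a *\<^sub>C x \<in> D)"

definition clinear_on :: "'a::complex_hilbert set \<Rightarrow> ('a \<Rightarrow> 'b::complex_hilbert) \<Rightarrow> bool" where
  "clinear_on D f \<longleftrightarrow>
     (\<forall>x\<in>D. \<forall>y\<in>D. f (x + y) = f x + f y) \<and> (\<forall>a. \<forall>x\<in>D. f (a *\<^sub>C x) = a *\<^sub>C f x)"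


section \<open>Unbounded operators\<close>

text \<open>
  An unbounded operator is represented by its graph; its domain is \<open>Domain A\<close>, its inverse
  (when injective) is the converse relation, and the composition of an operator with itself is
  \<open>A O A\<close>.
\<close>

type_synonym 'a unbdd_op = "('a \<times> 'a) set"

definition linear_op :: "'a::complex_hilbert unbdd_op \<Rightarrow> bool" where
  "linear_op A \<longleftrightarrow> single_valued A \<and> (0, 0) \<in> A \<and>
     (\<forall>x y x' y'. (x, y) \<in> A \<longrightarrow> (x', y') \<in> A \<longrightarrow> (x + x', y + y') \<in> A) \<and>
     (\<forall>a x y. (x, y) \<in> A \<longrightarrow> (a *\<^sub>C x, a *\<^sub>C y) \<in> A)"

definition op_app :: "'a unbdd_op \<Rightarrow> 'a \<Rightarrow> 'a" where
  "op_app A x = (THE y. (x, y) \<in> A)"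

definition op_adjoint :: "'a::complex_hilbert unbdd_op \<Rightarrow> 'a unbdd_op" where
  "op_adjoint A = {(y, z). \<forall>x w. (x, w) \<in> A \<longrightarrow> cinner w y = cinner x z}"

definition selfadjoint_op :: "'a::complex_hilbert unbdd_op \<Rightarrow> bool" where
  "selfadjoint_op A \<longleftrightarrow> linear_op A \<and> closure (Domain A) = UNIV \<and> op_adjoint A = A"

text \<open>
  Positive means nonnegative. For a self-adjoint operator \<open>cinner x y\<close> below is real.
\<close>

definition positive_selfadjoint_op :: "'a::complex_hilbert unbdd_op \<Rightarrow> bool" where
  "positive_selfadjoint_op A \<longleftrightarrow>
     selfadjoint_op A \<and> (\<forall>x y. (x, y) \<in> A \<longrightarrow> 0 \<le> Re (cinner x y))"

text \<open>
  A positive self-adjoint operator has exactly one positive self-adjoint square root, so the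
  choice operator picks out a determined operator.
\<close>

definition op_sqrt :: "'a::complex_hilbert unbdd_op \<Rightarrow> 'a unbdd_op" where
  "op_sqrt A = (SOME S. positive_selfadjoint_op S \<and> S O S = A)"

definition op_plus_one :: "'a::complex_hilbert unbdd_op \<Rightarrow> 'a unbdd_op" where
  "op_plus_one A = {(x, y + x) | x y. (x, y) \<in> A}"


section \<open>The scale of Hilbert spaces of a positive self-adjoint operator\<close>

definition Hplus :: "'a::complex_hilbert unbdd_op \<Rightarrow> 'a set" where
  "Hplus A = Domain (op_sqrt A)"

definition norm_plus :: "'a::complex_hilbert unbdd_op \<Rightarrow> 'a \<Rightarrow> real" where
  "norm_plus A \<Phi> = norm (op_app (op_sqrt (op_plus_one A)) \<Phi>)"

definition norm_minus :: "'a::complex_hilbert unbdd_op \<Rightarrow> 'a \<Rightarrow> real" where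
  "norm_minus A \<Phi> = norm (op_app ((op_sqrt (op_plus_one A))\<inverse>) \<Phi>)"

text \<open>
  A type cannot depend on \<open>A\<close>, so the completion of \<open>'a\<close> in the norm \<open>norm_minus A\<close> is given as
  a type \<open>'m\<close> together with the canonical embedding \<open>\<iota>\<close>: complete (by its type class), with \<open>\<iota>\<close>
  isometric for \<open>norm_minus A\<close> and of dense range. These properties determine it up to a unique
  isometric isomorphism. The operator \<open>op_sqrt (op_plus_one A)\<close> being invertible, such an \<open>'m\<close>
  always exists; even \<open>'a\<close> itself, embedded by the inverse of that operator, is one.
\<close>

definition minus_completion ::
    "'a::complex_hilbert unbdd_op \<Rightarrow> ('a \<Rightarrow> 'm::complex_hilbert) \<Rightarrow> bool" where
  "minus_completion A \<iota> \<longleftrightarrow>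
     clinear_on UNIV \<iota> \<and> (\<forall>x. norm (\<iota> x) = norm_minus A x) \<and> closure (range \<iota>) = UNIV"

text \<open>
  The pairings are the extensions by continuity of the inner product: the limits are taken
  along \<open>x\<close> in the Hilbert space with \<open>\<iota> x \<longlongrightarrow> m\<close> in the completion.
\<close>

definition pair_mp :: "('a::complex_hilbert \<Rightarrow> 'm::complex_hilbert) \<Rightarrow> 'm \<Rightarrow> 'a \<Rightarrow> complex" where
  "pair_mp \<iota> m \<Phi> = Lim (filtercomap \<iota> (nhds m)) (\<lambda>x. cinner x \<Phi>)"

definition pair_pm :: "('a::complex_hilbert \<Rightarrow> 'm::complex_hilbert) \<Rightarrow> 'a \<Rightarrow> 'm \<Rightarrow> complex" where
  "pair_pm \<iota> \<Psi> m = Lim (filtercomap \<iota> (nhds m)) (\<lambda>x. cinner \<Psi> x)"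

text \<open>
  The extension of \<open>A\<close> to an operator from \<open>Hplus A\<close> to the completion: the limit is taken along
  \<open>x\<close> in the domain of \<open>A\<close> converging to \<open>\<Phi>\<close> in \<open>norm_plus A\<close>.
\<close>

definition op_ext ::
    "('a::complex_hilbert \<Rightarrow> 'm::complex_hilbert) \<Rightarrow> 'a unbdd_op \<Rightarrow> 'a \<Rightarrow> 'm" where
  "op_ext \<iota> A \<Phi> =
     Lim (inf (filtercomap (\<lambda>x. norm_plus A (x - \<Phi>)) (nhds 0)) (principal (Domain A)))
       (\<lambda>x. \<iota> (op_app A x))"

definition bounded_plus_minus ::
    "'a::complex_hilbert unbdd_op \<Rightarrow> ('a \<Rightarrow> 'm::complex_hilbert) \<Rightarrow> bool" where
  "bounded_plus_minus A K \<longleftrightarrow>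
     clinear_on (Hplus A) K \<and> (\<exists>M. \<forall>\<Phi>\<in>Hplus A. norm (K \<Phi>) \<le> M * norm_plus A \<Phi>)"

text \<open>
  Inequality in the sense of quadratic forms, for symmetric operators from \<open>Hplus A\<close> to the
  completion, whose quadratic forms are real-valued.
\<close>

definition form_le ::
    "('a::complex_hilbert \<Rightarrow> 'm::complex_hilbert) \<Rightarrow> 'a unbdd_op \<Rightarrow> ('a \<Rightarrow> 'm) \<Rightarrow> ('a \<Rightarrow> 'm) \<Rightarrow> bool"
  where
  "form_le \<iota> A K L \<longleftrightarrow> (\<forall>\<Phi>\<in>Hplus A. Re (pair_pm \<iota> \<Phi> (K \<Phi>)) \<le> Re (pair_pm \<iota> \<Phi> (L \<Phi>)))"

text \<open>
  The restriction of \<open>K\<close> to an operator in the Hilbert space, with domain the vectors of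
  \<open>Hplus A\<close> that \<open>K\<close> maps into the Hilbert space.
\<close>

definition restrict_op ::
    "('a::complex_hilbert \<Rightarrow> 'm::complex_hilbert) \<Rightarrow> 'a unbdd_op \<Rightarrow> ('a \<Rightarrow> 'm) \<Rightarrow> 'a unbdd_op" where
  "restrict_op \<iota> A K = {(\<Phi>, y). \<Phi> \<in> Hplus A \<and> K \<Phi> = \<iota> y}"

text \<open>
  The inverse as a bounded operator; meaningful if \<open>A\<close> has a bounded everywhere defined inverse.
  The library's type of bounded operators consists of the real-linear ones; complex-linear ones
  form a closed subspace of it with the same norm.
\<close>

definition op_inverse :: "'a::complex_hilbert unbdd_op \<Rightarrow> 'a \<Rightarrow>\<^sub>L 'a" where
  "op_inverse A = Blinfun (op_app (A\<inverse>))"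


section \<open>Inner products on subspaces, and continuously differentiable functions\<close>

definition inner_product_on :: "'a::complex_hilbert set \<Rightarrow> ('a \<Rightarrow> 'a \<Rightarrow> complex) \<Rightarrow> bool" where
  "inner_product_on D ip \<longleftrightarrow>
     (\<forall>x\<in>D. \<forall>y\<in>D. ip x y = cnj (ip y x)) \<and>
     (\<forall>x\<in>D. \<forall>y\<in>D. \<forall>z\<in>D. ip x (y + z) = ip x y + ip x z) \<and>
     (\<forall>a. \<forall>x\<in>D. \<forall>y\<in>D. ip x (a *\<^sub>C y) = a * ip x y) \<and>
     (\<forall>x\<in>D. x \<noteq> 0 \<longrightarrow> 0 < Re (ip x x))"

definition ip_norm :: "('a \<Rightarrow> 'a \<Rightarrow> complex) \<Rightarrow> 'a \<Rightarrow> real" where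
  "ip_norm ip x = sqrt (Re (ip x x))"

definition hilbert_on :: "'a::complex_hilbert set \<Rightarrow> ('a \<Rightarrow> 'a \<Rightarrow> complex) \<Rightarrow> bool" where
  "hilbert_on D ip \<longleftrightarrow> csubspace D \<and> inner_product_on D ip \<and>
     (\<forall>X::nat \<Rightarrow> 'a. (\<forall>n. X n \<in> D) \<longrightarrow>
        (\<forall>e>0. \<exists>M. \<forall>m\<ge>M. \<forall>n\<ge>M. ip_norm ip (X m - X n) < e) \<longrightarrow>
        (\<exists>L\<in>D. (\<lambda>n. ip_norm ip (X n - L)) \<longlonglongrightarrow> 0))"

definition continuously_contained ::
    "'a::complex_hilbert set \<Rightarrow> ('a \<Rightarrow> 'a \<Rightarrow> complex) \<Rightarrow> bool" where
  "continuously_contained D ip \<longleftrightarrow> (\<exists>M. \<forall>x\<in>D. norm x \<le> M * ip_norm ip x)"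

text \<open>
  One-sided derivatives at the endpoints; the library's \<open>C1_differentiable_on\<close> would require
  two-sided ones.
\<close>

definition C1_on :: "real set \<Rightarrow> (real \<Rightarrow> complex) \<Rightarrow> bool" where
  "C1_on S f \<longleftrightarrow>
     (\<exists>f'. continuous_on S f' \<and> (\<forall>t\<in>S. (f has_vector_derivative f' t) (at t within S)))"

end

theory Submission
  imports Defs
begin

text \<open>
  With \<open>Q = (H\<^sub>0 + 1)\<^sup>-\<^sup>1\<^sup>/\<^sup>2\<close>, a bounded injective operator whose range is the form domain, the operator
  \<open>H(t)\<close> becomes a bounded symmetric operator \<open>K(t)\<close> with \<open>1/C \<le> K(t) \<le> C\<close>, the form of \<open>H(t)\<close> at \<open>Qx, Qy\<close>
  being \<open>\<langle>x, K(t)y\<rangle>\<close>; this gives (K1). The inverse of \<open>H(t)\<close> is \<open>Q Z(t) Q\<close> with \<open>Z(t) = K(t)\<^sup>-\<^sup>1\<close>, and (S2)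
  says that \<open>\<bar>\<langle>a, B(t)b\<rangle>\<bar> \<le> C\<^sup>2 \<parallel>Qa\<parallel> \<parallel>Qb\<parallel>\<close>. Since \<open>\<langle>Qa, Z(t)Qb\<rangle>\<close> has the derivative \<open>\<langle>a, B(t)b\<rangle>\<close>, it
  follows that \<open>Z\<close> is Lipschitz in norm and, the range of \<open>Q\<close> being dense, weakly \<open>C\<^sup>1\<close>. The same then
  holds for \<open>K\<close>, which is (K2).
\<close>


section \<open>Density and orthogonal projection\<close>

text \<open>(S2) differentiates \<open>Q o\<^sub>L Z t o\<^sub>L Q\<close>, and \<open>Q\<close> has
  in general no bounded inverse, so norm convergence of these difference quotients gives no control
  of those of \<open>Z\<close> in norm. Hence only matrix elements of \<open>Z\<close> are
  differentiated. The bound on \<open>B t\<close> in terms of \<open>Q a\<close> and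
  \<open>Q b\<close> makes their derivatives converge uniformly in \<open>t\<close> when
  \<open>Q a\<close> and \<open>Q b\<close> approach arbitrary vectors. The norm Lipschitz bound is
  what makes the error in passing from \<open>Z\<close> to its inverse quadratic in
  \<open>s - t\<close>. In the constant \<open>C\<^sup>2\<close>, one factor is that of (S2); the
  other is the bound on \<open>Z t\<close>, since \<open>H(t)^(-1/2) a\<close> has squared norm
  \<open>inner (Q a) (Z t (Q a))\<close>. The operator \<open>op_sqrt A\<close> is a choice, so all
  that is known of it is that it is positive, self-adjoint and squares to \<open>A\<close>. That
  such a root exists is shown without a spectral theorem: with \<open>R = (A + 1)^(-1)\<close> it is
  \<open>(1 - R)^(1/2) R^(-1/2)\<close>, built from bounded square roots.\<close>

lemma dense_range_sequence:
  fixes f :: "'a \<Rightarrow> 'b::metric_space"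
  assumes "closure (range f) = UNIV"
  shows "\<exists>a. (\<lambda>n. f (a n)) \<longlonglongrightarrow> x"
proof -
  have "x \<in> closure (range f)" by (simp add: assms)
  then obtain g where g: "\<forall>n. g n \<in> range f" "g \<longlonglongrightarrow> x" by (auto simp: closure_sequential)
  then have "\<forall>n. \<exists>a. g n = f a" by blast
  from choice[OF this] obtain a where "\<forall>n. g n = f (a n)" ..
  then have "g = (\<lambda>n. f (a n))" by auto
  then show ?thesis using g(2) by auto
qed

text \<open>A minimizing sequence is Cauchy by the parallelogram law: the midpoint of two of its
  terms lies in \<open>M\<close>, so its distance from \<open>v\<close> is at least
  \<open>d\<close>, which forces the terms together.\<close>

lemma exists_nearest_point:
  fixes M :: "'a::{real_inner,banach} set"
  assumes "subspace M" "closed M"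
  obtains p where "p \<in> M" "\<And>y. y \<in> M \<Longrightarrow> norm (v - p) \<le> norm (v - y)"
proof -
  define d where "d = (INF y\<in>M. norm (v - y))"
  have ne: "M \<noteq> {}" using assms(1) subspace_0 by blast
  have bdd: "bdd_below ((\<lambda>y. norm (v - y)) ` M)" by (rule bdd_belowI[of _ 0]) auto
  have d_le: "d \<le> norm (v - y)" if "y \<in> M" for y
    unfolding d_def by (rule cINF_lower[OF bdd that])
  have d0: "0 \<le> d" unfolding d_def by (rule cINF_greatest[OF ne]) auto
  have "\<exists>y\<in>M. norm (v - y) < d + inverse (real (Suc n))" for n
  proof -
    have "Inf ((\<lambda>y. norm (v - y)) ` M) < d + inverse (real (Suc n))" unfolding d_def by simp
    then show ?thesis using cInf_less_iff[OF _ bdd] ne by auto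
  qed
  then obtain y where y: "\<And>n. y n \<in> M" "\<And>n. norm (v - y n) < d + inverse (real (Suc n))"
    by metis
  have conv: "(\<lambda>n. d + inverse (real (Suc n))) \<longlonglongrightarrow> d"
    using tendsto_add[OF tendsto_const LIMSEQ_inverse_real_of_nat, of d] by simp
  have lim: "(\<lambda>n. norm (v - y n)) \<longlonglongrightarrow> d"
    by (rule tendsto_sandwich[OF _ _ tendsto_const conv])
      (use d_le y in \<open>auto intro!: always_eventually less_imp_le\<close>)
  have par: "(norm (y m - y n))\<^sup>2 \<le> 2 * (norm (v - y m))\<^sup>2 + 2 * (norm (v - y n))\<^sup>2 - 4 * d\<^sup>2" for m n
  proof -
    have "(1/2) *\<^sub>R (y m + y n) \<in> M"
      using y(1) assms(1) by (simp add: subspace_add subspace_scale)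
    from d_le[OF this] have "d\<^sup>2 \<le> (norm (v - (1/2) *\<^sub>R (y m + y n)))\<^sup>2"
      using d0 by (simp add: power_mono)
    moreover have "(norm (y m - y n))\<^sup>2 + 4 * (norm (v - (1/2) *\<^sub>R (y m + y n)))\<^sup>2
        = 2 * (norm (v - y m))\<^sup>2 + 2 * (norm (v - y n))\<^sup>2"
      by (simp add: power2_norm_eq_inner inner_diff_left inner_diff_right inner_add_left
          inner_add_right inner_commute algebra_simps)
    ultimately show ?thesis by linarith
  qed
  have "Cauchy y"
  proof (rule metric_CauchyI)
    fix e :: real assume e: "e > 0"
    have "(\<lambda>n. (norm (v - y n))\<^sup>2) \<longlonglongrightarrow> d\<^sup>2" by (rule tendsto_power[OF lim])
    then have "eventually (\<lambda>n. (norm (v - y n))\<^sup>2 < d\<^sup>2 + e\<^sup>2 / 4) sequentially"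
      using e by (intro order_tendstoD) auto
    then obtain N where N: "\<And>n. n \<ge> N \<Longrightarrow> (norm (v - y n))\<^sup>2 < d\<^sup>2 + e\<^sup>2 / 4"
      by (auto simp: eventually_sequentially)
    have "dist (y m) (y n) < e" if "m \<ge> N" "n \<ge> N" for m n
    proof -
      have "(norm (y m - y n))\<^sup>2 < e\<^sup>2" using par[of m n] N[OF that(1)] N[OF that(2)] by argo
      then show ?thesis using e by (simp add: dist_norm power_less_imp_less_base)
    qed
    then show "\<exists>N. \<forall>m\<ge>N. \<forall>n\<ge>N. dist (y m) (y n) < e" by blast
  qed
  then obtain p where p: "y \<longlonglongrightarrow> p" using Cauchy_convergent_iff convergent_def by blast
  have "p \<in> M" using closed_sequentially[OF assms(2)] y(1) p by blast
  moreover have "norm (v - p) = d"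
    by (rule LIMSEQ_unique[OF _ lim]) (intro tendsto_intros p)
  ultimately show ?thesis using that d_le by metis
qed

lemma exists_orthogonal_projection:
  fixes M :: "'a::{real_inner,banach} set"
  assumes "subspace M" "closed M"
  obtains p where "p \<in> M" "\<And>y. y \<in> M \<Longrightarrow> inner (v - p) y = 0"
proof -
  obtain p where p: "p \<in> M" "\<And>y. y \<in> M \<Longrightarrow> norm (v - p) \<le> norm (v - y)"
    using exists_nearest_point[OF assms] by metis
  have expand: "(norm (a - b))\<^sup>2 = (norm a)\<^sup>2 - 2 * inner a b + (norm b)\<^sup>2" for a b :: 'a
    by (simp add: power2_norm_eq_inner inner_diff_left inner_diff_right inner_commute)
  have "inner (v - p) y = 0" if y: "y \<in> M" for y
  proof (cases "y = 0")
    case False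
    \<comment> \<open>This \<open>c\<close> makes \<open>c *\<^sub>R y\<close> the projection of
      \<open>v - p\<close> onto the line through \<open>y\<close>; moving \<open>p\<close> by it
      lowers the squared distance by
      \<open>(inner (v - p) y)\<^sup>2 / (norm y)\<^sup>2\<close>.\<close>
    define c where "c = inner (v - p) y / (norm y)\<^sup>2"
    have "p + c *\<^sub>R y \<in> M" using p(1) y assms(1) by (simp add: subspace_add subspace_scale)
    then have "(norm (v - p))\<^sup>2 \<le> (norm (v - (p + c *\<^sub>R y)))\<^sup>2"
      using p(2) by (simp add: power_mono)
    also have "\<dots> = (norm ((v - p) - c *\<^sub>R y))\<^sup>2" by (simp add: algebra_simps)
    also have "\<dots> = (norm (v - p))\<^sup>2 - 2 * c * inner (v - p) y + c\<^sup>2 * (norm y)\<^sup>2"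
      using expand[of "v - p" "c *\<^sub>R y"] by (simp add: power_mult_distrib)
    also have "\<dots> = (norm (v - p))\<^sup>2 - (inner (v - p) y)\<^sup>2 / (norm y)\<^sup>2"
      using False by (simp add: c_def power2_eq_square field_simps)
    finally have "(inner (v - p) y)\<^sup>2 / (norm y)\<^sup>2 \<le> 0" by simp
    then show ?thesis using False by (simp add: divide_le_0_iff)
  qed simp
  then show ?thesis using that p(1) by blast
qed

lemma subspace_closure:
  fixes M :: "'a::real_normed_vector set"
  assumes "subspace M"
  shows "subspace (closure M)"
  unfolding subspace_def
proof (intro conjI ballI allI)
  show "0 \<in> closure M" using assms closure_subset subspace_0 by blast
  fix x assume "x \<in> closure M"
  then obtain f where f: "\<And>n. f n \<in> M" "f \<longlonglongrightarrow> x" by (auto simp: closure_sequential)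
  show "c *\<^sub>R x \<in> closure M" for c
    unfolding closure_sequential
    by (rule exI[of _ "\<lambda>n. c *\<^sub>R f n"])
      (use f assms in \<open>auto intro!: tendsto_intros simp: subspace_scale\<close>)
  fix y assume "y \<in> closure M"
  then obtain g where g: "\<And>n. g n \<in> M" "g \<longlonglongrightarrow> y" by (auto simp: closure_sequential)
  show "x + y \<in> closure M"
    unfolding closure_sequential
    by (rule exI[of _ "\<lambda>n. f n + g n"])
      (use f g assms in \<open>auto intro!: tendsto_intros simp: subspace_add\<close>)
qed

lemma subspace_dense:
  fixes M :: "'a::{real_inner,banach} set"
  assumes "subspace M" and "\<And>z. (\<And>y. y \<in> M \<Longrightarrow> inner z y = 0) \<Longrightarrow> z = 0"
  shows "closure M = UNIV"
proof -
  have "v \<in> closure M" for v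
  proof -
    obtain p where p: "p \<in> closure M" "\<And>y. y \<in> closure M \<Longrightarrow> inner (v - p) y = 0"
      using exists_orthogonal_projection[OF subspace_closure[OF assms(1)] closed_closure] by metis
    have "v - p = 0" by (rule assms(2)) (use p(2) closure_subset in blast)
    then show ?thesis using p(1) by simp
  qed
  then show ?thesis by blast
qed


section \<open>The underlying real Hilbert space\<close>

lemma scaleC_conv: "a *\<^sub>C (x::'a::complex_hilbert) = Re a *\<^sub>R x + Im a *\<^sub>R (\<i> *\<^sub>C x)"
proof -
  have "a = complex_of_real (Re a) + complex_of_real (Im a) * \<i>"
    by (metis complex_eq mult.commute)
  then show ?thesis by (metis scaleC_add_left scaleC_of_real scaleC_scaleC)
qed

text \<open>Multiplying the second argument by \<i> turns the imaginary part, up to sign, into a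
  real part. The real inner product therefore carries all of \<open>cinner\<close>, and limits,
  adjoints and symmetry can be treated in the real theory.\<close>

lemma cinner_conv: "cinner x (y::'a::complex_hilbert) = Complex (inner x y) (- inner x (\<i> *\<^sub>C y))"
proof -
  have "Re (cinner x (\<i> *\<^sub>C y)) = - Im (cinner x y)"
    by (simp add: cinner_scaleC_right)
  then show ?thesis by (simp add: Re_cinner complex_eq_iff)
qed

lemma cinner_scaleC_left: "cinner (a *\<^sub>C x) (y::'a::complex_hilbert) = cnj a * cinner x y"
  by (metis cinner_commute cinner_scaleC_right complex_cnj_mult complex_cnj_cnj)

lemma norm_scaleC: "norm (a *\<^sub>C (x::'a::complex_hilbert)) = cmod a * norm x"
proof -
  have "cinner (a *\<^sub>C x) (a *\<^sub>C x) = (cnj a * a) * cinner x x"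
    by (simp add: cinner_scaleC_left cinner_scaleC_right)
  also have "cnj a * a = complex_of_real ((cmod a)\<^sup>2)"
    by (metis complex_norm_square mult.commute of_real_power)
  finally have "inner (a *\<^sub>C x) (a *\<^sub>C x) = (cmod a)\<^sup>2 * inner x x"
    by (simp add: Re_cinner[symmetric])
  then show ?thesis by (simp add: norm_eq_sqrt_inner real_sqrt_mult)
qed

lemma scaleC_scaleR: "a *\<^sub>C r *\<^sub>R (x::'a::complex_hilbert) = r *\<^sub>R a *\<^sub>C x"
  by (metis mult.commute scaleC_of_real scaleC_scaleC)

lemma bounded_linear_scaleC: "bounded_linear (\<lambda>x::'a::complex_hilbert. a *\<^sub>C x)"
  by (rule bounded_linear_intro[of _ "cmod a"])
    (simp_all add: scaleC_add_right norm_scaleC scaleC_scaleR mult.commute)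

lemma inner_scaleC_i: "inner (\<i> *\<^sub>C x) (y::'a::complex_hilbert) = - inner x (\<i> *\<^sub>C y)"
  by (simp add: Re_cinner[symmetric] cinner_scaleC_left cinner_scaleC_right)

lemma tendsto_cinner [tendsto_intros]:
  fixes f g :: "'b \<Rightarrow> 'a::complex_hilbert"
  assumes "(f \<longlongrightarrow> a) F" "(g \<longlongrightarrow> b) F"
  shows "((\<lambda>x. cinner (f x) (g x)) \<longlongrightarrow> cinner a b) F"
  unfolding cinner_conv
  by (intro tendsto_intros assms bounded_linear.tendsto[OF bounded_linear_scaleC])

text \<open>The type supplies boundedness and real linearity. Symmetry is asked for the real inner
  product; together with complex linearity it gives symmetry for \<open>cinner\<close>, see
  \<open>clinear_sym_cinner\<close>.\<close>

definition clinear_sym :: "('a::complex_hilbert \<Rightarrow>\<^sub>L 'a) \<Rightarrow> bool" where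
  "clinear_sym S \<longleftrightarrow> (\<forall>a x. blinfun_apply S (a *\<^sub>C x) = a *\<^sub>C blinfun_apply S x) \<and>
     (\<forall>x y. inner (blinfun_apply S x) y = inner x (blinfun_apply S y))"

lemma clinear_symI:
  assumes "\<And>x. blinfun_apply S (\<i> *\<^sub>C x) = \<i> *\<^sub>C blinfun_apply S x"
    and "\<And>x y. inner (blinfun_apply S x) y = inner x (blinfun_apply S y)"
  shows "clinear_sym S"
  unfolding clinear_sym_def
proof (intro conjI allI assms(2))
  fix a x
  show "blinfun_apply S (a *\<^sub>C x) = a *\<^sub>C blinfun_apply S x"
    by (simp add: scaleC_conv[of a] blinfun.add_right blinfun.scaleR_right assms(1))
qed

lemma clinear_sym_scaleC: "clinear_sym S \<Longrightarrow> blinfun_apply S (a *\<^sub>C x) = a *\<^sub>C blinfun_apply S x"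
  and clinear_sym_inner: "clinear_sym S \<Longrightarrow> inner (blinfun_apply S x) y = inner x (blinfun_apply S y)"
  by (simp_all add: clinear_sym_def)

lemma clinear_sym_cinner:
  "clinear_sym S \<Longrightarrow> cinner (blinfun_apply S x) y = cinner x (blinfun_apply S y)"
  by (simp add: cinner_conv clinear_sym_inner clinear_sym_scaleC[symmetric])


section \<open>Bounded symmetric operators\<close>

lemma scaleC_zero_right [simp]: "a *\<^sub>C (0::'a::complex_hilbert) = 0"
  and scaleC_diff_right: "a *\<^sub>C ((x::'a) - y) = a *\<^sub>C x - a *\<^sub>C y"
  by (rule linear_0 linear_diff, rule bounded_linear.linear[OF bounded_linear_scaleC])+

lemma blinfun_compose_assoc: "(X o\<^sub>L Y) o\<^sub>L Z = X o\<^sub>L (Y o\<^sub>L Z)"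
  by (rule blinfun_eqI) simp

lemmas blinfun_compose_tendsto = bounded_bilinear.tendsto[OF bounded_bilinear_blinfun_compose]
  and blinfun_compose_diff_left = bounded_bilinear.diff_left[OF bounded_bilinear_blinfun_compose]
  and blinfun_compose_diff_right = bounded_bilinear.diff_right[OF bounded_bilinear_blinfun_compose]
  and blinfun_compose_add_left = bounded_bilinear.add_left[OF bounded_bilinear_blinfun_compose]
  and blinfun_compose_add_right = bounded_bilinear.add_right[OF bounded_bilinear_blinfun_compose]
  and blinfun_compose_scaleR_left = bounded_bilinear.scaleR_left[OF bounded_bilinear_blinfun_compose]
  and blinfun_compose_scaleR_right = bounded_bilinear.scaleR_right[OF bounded_bilinear_blinfun_compose]

lemma clinear_sym_limit:
  assumes "\<And>n. clinear_sym (Y n)" "Y \<longlonglongrightarrow> Z"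
  shows "clinear_sym Z"
proof (rule clinear_symI)
  have lim: "(\<lambda>n. blinfun_apply (Y n) x) \<longlonglongrightarrow> blinfun_apply Z x" for x
    by (intro tendsto_intros assms(2))
  fix x y
  have "(\<lambda>n. blinfun_apply (Y n) (\<i> *\<^sub>C x)) \<longlonglongrightarrow> \<i> *\<^sub>C blinfun_apply Z x"
    using bounded_linear.tendsto[OF bounded_linear_scaleC lim[of x], of \<i>]
    by (simp add: clinear_sym_scaleC[OF assms(1)])
  then show "blinfun_apply Z (\<i> *\<^sub>C x) = \<i> *\<^sub>C blinfun_apply Z x"
    using lim LIMSEQ_unique by blast
  have "(\<lambda>n. inner (blinfun_apply (Y n) x) y) \<longlonglongrightarrow> inner (blinfun_apply Z x) y"
    "(\<lambda>n. inner x (blinfun_apply (Y n) y)) \<longlonglongrightarrow> inner x (blinfun_apply Z y)"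
    by (intro tendsto_intros lim)+
  then show "inner (blinfun_apply Z x) y = inner x (blinfun_apply Z y)"
    using LIMSEQ_unique by (simp add: clinear_sym_inner[OF assms(1)])
qed

text \<open>
  With \<open>X = 1 - R\<close>, the recursion below converges in norm even when \<open>norm X = 1\<close>: its increments
  are dominated by those of the same recursion started with the number 1 in place of \<open>X\<close>,
  which increases and is bounded by 1.
\<close>

fun sqrt_iter :: "('a::real_normed_vector \<Rightarrow>\<^sub>L 'a) \<Rightarrow> nat \<Rightarrow> ('a \<Rightarrow>\<^sub>L 'a)" where
  "sqrt_iter X 0 = 0"
| "sqrt_iter X (Suc n) = (1/2) *\<^sub>R (X + (sqrt_iter X n o\<^sub>L sqrt_iter X n))"

fun sqrt_majorant :: "nat \<Rightarrow> real" where
  "sqrt_majorant 0 = 0"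
| "sqrt_majorant (Suc n) = (1 + (sqrt_majorant n)\<^sup>2) / 2"

lemma sqrt_majorant_bounds: "0 \<le> sqrt_majorant n \<and> sqrt_majorant n \<le> 1"
proof (induction n)
  case (Suc n)
  then have "(sqrt_majorant n)\<^sup>2 \<le> 1" by (simp add: power_le_one)
  then show ?case by simp
qed simp

lemma norm_sqrt_iter:
  assumes "norm X \<le> 1"
  shows "norm (sqrt_iter X n) \<le> sqrt_majorant n"
proof (induction n)
  case (Suc n)
  have "norm (sqrt_iter X n o\<^sub>L sqrt_iter X n) \<le> sqrt_majorant n * sqrt_majorant n"
    by (rule order_trans[OF norm_blinfun_compose mult_mono])
      (use Suc sqrt_majorant_bounds in auto)
  then have "norm (X + (sqrt_iter X n o\<^sub>L sqrt_iter X n)) \<le> 1 + (sqrt_majorant n)\<^sup>2"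
    using assms norm_triangle_ineq[of X "sqrt_iter X n o\<^sub>L sqrt_iter X n"]
    by (simp add: power2_eq_square)
  then show ?case by simp
qed simp

text \<open>A difference of squares splits without commutativity,
  \<open>Y' Y' - Y Y = Y' (Y' - Y) + (Y' - Y) Y\<close>. The majorant obeys the same identity, so
  bounds on the factors multiply to its next increment.\<close>

lemma norm_sqrt_iter_diff:
  assumes "norm X \<le> 1"
  shows "norm (sqrt_iter X (Suc n) - sqrt_iter X n) \<le> sqrt_majorant (Suc n) - sqrt_majorant n"
proof (induction n)
  case 0
  then show ?case using assms by simp
next
  case (Suc n)
  define Y Y' y y' where "Y = sqrt_iter X n" and "Y' = sqrt_iter X (Suc n)"
    and "y = sqrt_majorant n" and "y' = sqrt_majorant (Suc n)"
  have b: "norm Y \<le> y" "norm Y' \<le> y'" "norm (Y' - Y) \<le> y' - y"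
    using norm_sqrt_iter[OF assms] Suc unfolding Y_def Y'_def y_def y'_def by blast+
  have y0: "0 \<le> y" "0 \<le> y'" "0 \<le> y' - y"
    using sqrt_majorant_bounds b(3) norm_ge_zero order_trans unfolding y_def y'_def by blast+
  have "sqrt_iter X (Suc (Suc n)) - Y' = (1/2) *\<^sub>R ((Y' o\<^sub>L Y') - (Y o\<^sub>L Y))"
    unfolding Y_def Y'_def sqrt_iter.simps(2)[of X "Suc n"] by (simp add: scaleR_diff_right scaleR_add_right)
  also have "(Y' o\<^sub>L Y') - (Y o\<^sub>L Y) = (Y' o\<^sub>L (Y' - Y)) + ((Y' - Y) o\<^sub>L Y)"
    by (simp add: blinfun_compose_diff_left blinfun_compose_diff_right)
  also have "norm ((1/2) *\<^sub>R ((Y' o\<^sub>L (Y' - Y)) + ((Y' - Y) o\<^sub>L Y))) \<le> (y' * (y' - y) + (y' - y) * y) / 2"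
  proof -
    have "norm (Y' o\<^sub>L (Y' - Y)) \<le> y' * (y' - y)" "norm ((Y' - Y) o\<^sub>L Y) \<le> (y' - y) * y"
      by (rule order_trans[OF norm_blinfun_compose mult_mono]; use b y0 in simp)+
    then show ?thesis
      using norm_triangle_ineq[of "Y' o\<^sub>L (Y' - Y)" "(Y' - Y) o\<^sub>L Y"] by simp
  qed
  also have "\<dots> = sqrt_majorant (Suc (Suc n)) - y'"
    unfolding y_def y'_def by (simp add: power2_eq_square field_simps)
  finally show ?case by (simp add: Y'_def y'_def)
qed

lemma norm_sqrt_iter_diff_add:
  assumes "norm X \<le> 1"
  shows "norm (sqrt_iter X (n + k) - sqrt_iter X n) \<le> sqrt_majorant (n + k) - sqrt_majorant n"
proof (induction k)
  case (Suc k)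
  have "norm (sqrt_iter X (n + Suc k) - sqrt_iter X n)
      \<le> norm (sqrt_iter X (Suc (n + k)) - sqrt_iter X (n + k))
        + norm (sqrt_iter X (n + k) - sqrt_iter X n)"
    using norm_triangle_ineq[of "sqrt_iter X (Suc (n + k)) - sqrt_iter X (n + k)"
        "sqrt_iter X (n + k) - sqrt_iter X n"] by (simp del: sqrt_iter.simps)
  also have "\<dots> \<le> sqrt_majorant (n + Suc k) - sqrt_majorant n"
    using norm_sqrt_iter_diff[OF assms, of "n + k"] Suc by (simp del: sqrt_iter.simps sqrt_majorant.simps)
  finally show ?case .
qed simp

lemma Cauchy_sqrt_iter:
  fixes X :: "'a::real_normed_vector \<Rightarrow>\<^sub>L 'a"
  assumes "norm X \<le> 1"
  shows "Cauchy (sqrt_iter X)"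
proof -
  have "incseq sqrt_majorant"
  proof (rule incseq_SucI)
    \<comment> \<open>The increments of the majorant bound norms and so are nonnegative; any
      operator of norm at most 1 shows this, here zero on the reals.\<close>
    show "sqrt_majorant n \<le> sqrt_majorant (Suc n)" for n
      using norm_sqrt_iter_diff[of "0 :: real \<Rightarrow>\<^sub>L real" n]
        norm_ge_zero[of "sqrt_iter (0 :: real \<Rightarrow>\<^sub>L real) (Suc n) - sqrt_iter 0 n"]
      unfolding norm_zero by linarith
  qed
  moreover have "\<bar>sqrt_majorant n\<bar> \<le> 1" for n using sqrt_majorant_bounds[of n] by simp
  ultimately have "Cauchy sqrt_majorant"
    by (metis Bseq_mono_convergent BseqI' convergent_Cauchy incseq_def real_norm_def)
  show ?thesis
  proof (rule CauchyI')
    fix e :: real assume "e > 0"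
    then obtain N where N: "\<And>m n. m \<ge> N \<Longrightarrow> n \<ge> N \<Longrightarrow> \<bar>sqrt_majorant m - sqrt_majorant n\<bar> < e"
      using CauchyD[OF \<open>Cauchy sqrt_majorant\<close>] by (metis real_norm_def)
    have "norm (sqrt_iter X m - sqrt_iter X n) < e" if mn: "m \<ge> N" "n > m" for m n
    proof -
      obtain k where "n = m + k" using mn(2) less_imp_add_positive by blast
      then show ?thesis
        using norm_sqrt_iter_diff_add[OF assms, of m k] N[of n m] mn by (simp add: norm_minus_commute)
    qed
    then show "\<exists>M. \<forall>m\<ge>M. \<forall>n>m. dist (sqrt_iter X m) (sqrt_iter X n) < e"
      by (metis dist_norm)
  qed
qed

text \<open>A solution of \<open>Y = (X + Y Y) / 2\<close> satisfies
  \<open>(1 - Y)(1 - Y) = 1 - X = R\<close>, so \<open>1 - Y\<close> is the root, for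
  \<open>Y\<close> the limit of the iteration. What commutes with \<open>R\<close> commutes with
  every iterate and hence with \<open>Y\<close>. The norm bound returned has the form of the
  hypothesis, so the root has a root in turn.\<close>

lemma exists_bounded_sqrt:
  fixes R :: "'a::complex_hilbert \<Rightarrow>\<^sub>L 'a"
  assumes R: "clinear_sym R" and norm_R: "norm (id_blinfun - R) \<le> 1"
  obtains S where "clinear_sym S" "S o\<^sub>L S = R" "norm (id_blinfun - S) \<le> 1"
    "\<And>Z. Z o\<^sub>L R = R o\<^sub>L Z \<Longrightarrow> Z o\<^sub>L S = S o\<^sub>L Z"
proof -
  define X where "X = id_blinfun - R"
  obtain Y where Y: "sqrt_iter X \<longlonglongrightarrow> Y"
    using Cauchy_sqrt_iter norm_R Cauchy_convergent_iff convergent_def unfolding X_def by blast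
  have nX: "norm X \<le> 1" using norm_R X_def by simp
  have symX: "clinear_sym X"
    unfolding X_def using R
    by (intro clinear_symI) (simp_all add: blinfun.diff_left clinear_sym_scaleC clinear_sym_inner
        inner_diff_left inner_diff_right scaleC_diff_right)
  have sym: "clinear_sym (sqrt_iter X n)" for n
  proof (induction n)
    case 0
    show ?case
      by (intro clinear_symI) simp_all
  next
    case (Suc n)
    then show ?case using symX
      by (intro clinear_symI) (simp_all add: blinfun.scaleR_left blinfun.add_left clinear_sym_scaleC
          clinear_sym_inner inner_add_left inner_add_right scaleC_add_right scaleC_scaleR)
  qed
  have Y_eq: "Y = (1/2) *\<^sub>R (X + (Y o\<^sub>L Y))"
  proof (rule LIMSEQ_unique[OF LIMSEQ_Suc[OF Y]])
    show "(\<lambda>n. sqrt_iter X (Suc n)) \<longlonglongrightarrow> (1/2) *\<^sub>R (X + (Y o\<^sub>L Y))"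
      unfolding sqrt_iter.simps by (intro tendsto_intros blinfun_compose_tendsto Y)
  qed
  have normY: "norm Y \<le> 1"
    by (rule LIMSEQ_le_const2[OF tendsto_norm[OF Y]])
      (use norm_sqrt_iter[OF nX] sqrt_majorant_bounds order_trans in blast)
  show ?thesis
  proof
    have symY: "clinear_sym Y" using clinear_sym_limit[OF sym Y] .
    then show "clinear_sym (id_blinfun - Y)"
      by (intro clinear_symI) (simp_all add: blinfun.diff_left clinear_sym_scaleC clinear_sym_inner
        inner_diff_left inner_diff_right scaleC_diff_right)
    have two: "Y + Y = X + (Y o\<^sub>L Y)"
      using Y_eq by (metis scaleR_half_double scaleR_right.add)
    show "(id_blinfun - Y) o\<^sub>L (id_blinfun - Y) = R"
    proof (rule blinfun_eqI)
      fix x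
      have "blinfun_apply (Y + Y) x = blinfun_apply (X + (Y o\<^sub>L Y)) x" using two by simp
      then show "blinfun_apply ((id_blinfun - Y) o\<^sub>L (id_blinfun - Y)) x = blinfun_apply R x"
        by (simp add: X_def blinfun.diff_left blinfun.diff_right blinfun.add_left algebra_simps)
    qed
    show "norm (id_blinfun - (id_blinfun - Y)) \<le> 1" using normY by simp
    fix Z assume Z: "Z o\<^sub>L R = R o\<^sub>L Z"
    have idc: "Z o\<^sub>L id_blinfun = Z" "id_blinfun o\<^sub>L Z = Z" by (auto intro: blinfun_eqI)
    have ZX: "Z o\<^sub>L X = X o\<^sub>L Z"
      unfolding X_def by (simp add: blinfun_compose_diff_left blinfun_compose_diff_right Z idc)
    have Zn: "Z o\<^sub>L sqrt_iter X n = sqrt_iter X n o\<^sub>L Z" for n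
    proof (induction n)
      case (Suc n)
      have "Z o\<^sub>L (sqrt_iter X n o\<^sub>L sqrt_iter X n) = (sqrt_iter X n o\<^sub>L sqrt_iter X n) o\<^sub>L Z"
        using Suc by (metis blinfun_compose_assoc)
      then show ?case
        by (simp add: blinfun_compose_scaleR_left blinfun_compose_scaleR_right
            blinfun_compose_add_left blinfun_compose_add_right ZX)
    qed (auto intro: blinfun_eqI)
    have "Z o\<^sub>L Y = Y o\<^sub>L Z"
    proof (rule LIMSEQ_unique)
      show "(\<lambda>n. Z o\<^sub>L sqrt_iter X n) \<longlonglongrightarrow> (Z o\<^sub>L Y)"
        by (intro blinfun_compose_tendsto tendsto_const Y)
      show "(\<lambda>n. Z o\<^sub>L sqrt_iter X n) \<longlonglongrightarrow> (Y o\<^sub>L Z)"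
        unfolding Zn by (intro blinfun_compose_tendsto tendsto_const Y)
    qed
    then show "Z o\<^sub>L (id_blinfun - Y) = (id_blinfun - Y) o\<^sub>L Z"
      by (simp add: blinfun_compose_diff_left blinfun_compose_diff_right idc)
  qed
qed

text \<open>Cauchy-Schwarz gives \<open>inner x (x - S x) \<le> (norm x)\<^sup>2\<close>, which is
  the claim. Distance at most 1 from the identity thus serves as a certificate of positivity for the
  roots constructed above.\<close>

lemma inner_nonneg_if_near_id:
  assumes "norm (id_blinfun - S) \<le> 1"
  shows "0 \<le> inner (x::'a::real_inner) (blinfun_apply S x)"
proof -
  have "norm (x - blinfun_apply S x) \<le> norm x"
    using norm_blinfun[of "id_blinfun - S" x] assms mult_right_mono[OF assms, of "norm x"]
    by (simp add: blinfun.diff_left)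
  then have "inner x (x - blinfun_apply S x) \<le> norm x * norm x"
    using norm_cauchy_schwarz[of x "x - blinfun_apply S x"]
    by (meson mult_left_mono norm_ge_zero order_trans)
  then show ?thesis by (simp add: inner_diff_right power2_norm_eq_inner[symmetric] power2_eq_square)
qed

section \<open>Ranges and inverses of bounded symmetric operators\<close>

lemma subspace_range_blinfun: "subspace (range (blinfun_apply S))"
  by (rule linear_subspace_image) (simp_all add: bounded_linear.linear[OF blinfun.bounded_linear_right])

text \<open>The orthogonal complement of the range of a symmetric operator is its kernel.\<close>

lemma dense_range_sym:
  assumes "clinear_sym S" "inj (blinfun_apply S)"
  shows "closure (range (blinfun_apply S)) = UNIV"
proof (rule subspace_dense[OF subspace_range_blinfun])
  fix z assume "\<And>y. y \<in> range (blinfun_apply S) \<Longrightarrow> inner z y = 0"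
  then have "inner (blinfun_apply S z) (blinfun_apply S z) = 0"
    using clinear_sym_inner[OF assms(1)] by simp
  then have "blinfun_apply S z = blinfun_apply S 0" by (simp add: blinfun.zero_right)
  then show "z = 0" using assms(2) by (simp only: inj_eq)
qed

text \<open>The lower bound on the form gives \<open>c * norm x \<le> norm (K x)\<close>, hence
  injectivity and a complete, so closed, range. By symmetry the range is also dense. Positivity of
  the inverse is that of \<open>K\<close> at \<open>Z x\<close>.\<close>

lemma exists_inverse_sym:
  assumes K: "clinear_sym K" and c: "c > 0"
    and below: "\<And>x. c * (norm x)\<^sup>2 \<le> inner x (blinfun_apply K x)"
  obtains Z where "clinear_sym Z" "\<And>x. blinfun_apply Z (blinfun_apply K x) = x"
    "\<And>x. blinfun_apply K (blinfun_apply Z x) = x" "\<And>x. 0 \<le> inner x (blinfun_apply Z x)"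
    "norm Z \<le> inverse c"
proof -
  have low: "c * norm x \<le> norm (blinfun_apply K x)" for x
  proof (cases "x = 0")
    case False
    have "c * (norm x)\<^sup>2 \<le> norm x * norm (blinfun_apply K x)"
      using below norm_cauchy_schwarz order_trans by blast
    then show ?thesis using False by (simp add: power2_eq_square)
  qed simp
  have inj: "inj (blinfun_apply K)"
  proof (rule injI)
    fix x y assume "blinfun_apply K x = blinfun_apply K y"
    then have "norm (blinfun_apply K (x - y)) = 0" by (simp add: blinfun.diff_right)
    then have "c * norm (x - y) \<le> 0" using low by metis
    then show "x = y" using c by (simp add: mult_le_0_iff)
  qed
  have "complete (range (blinfun_apply K))"
    by (rule complete_isometric_image[OF c subspace_UNIV blinfun.bounded_linear_right])
      (use low complete_UNIV in auto)
  then have surj: "range (blinfun_apply K) = UNIV"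
    using dense_range_sym[OF K inj] by (metis closure_closed complete_imp_closed)
  define Z where "Z = inv (blinfun_apply K)"
  have KZ: "blinfun_apply K (Z x) = x" and ZK: "Z (blinfun_apply K x) = x" for x
    using surj inj unfolding Z_def by (simp_all add: surj_f_inv_f)
  have nZ: "norm (Z x) \<le> norm x * inverse c" for x
    using low[of "Z x"] c by (simp add: KZ field_simps)
  have bl: "bounded_linear Z"
  proof (rule bounded_linear_intro[OF _ _ nZ])
    show "Z (x + y) = Z x + Z y" for x y by (metis KZ ZK blinfun.add_right)
    show "Z (r *\<^sub>R x) = r *\<^sub>R Z x" for r x by (metis KZ ZK blinfun.scaleR_right)
  qed
  note app = bounded_linear_Blinfun_apply[OF bl]
  show ?thesis
  proof
    show "clinear_sym (Blinfun Z)"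
    proof (rule clinear_symI; unfold app)
      show "Z (\<i> *\<^sub>C x) = \<i> *\<^sub>C Z x" for x by (metis KZ ZK clinear_sym_scaleC[OF K])
      show "inner (Z x) y = inner x (Z y)" for x y by (metis KZ clinear_sym_inner[OF K])
    qed
    show "blinfun_apply (Blinfun Z) (blinfun_apply K x) = x"
      "blinfun_apply K (blinfun_apply (Blinfun Z) x) = x" for x by (simp_all add: app KZ ZK)
    have "0 \<le> inner y (blinfun_apply K y)" for y
      using below[of y] c by (meson less_imp_le mult_nonneg_nonneg order_trans zero_le_power2)
    then show "0 \<le> inner x (blinfun_apply (Blinfun Z) x)" for x
      by (metis KZ app inner_commute)
    show "norm (Blinfun Z) \<le> inverse c"
      by (rule norm_blinfun_bound) (use nZ c in \<open>auto simp: app mult.commute\<close>)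
  qed
qed


section \<open>Unbounded self-adjoint operators\<close>

lemma linear_opD:
  assumes "linear_op A"
  shows "(x, y) \<in> A \<Longrightarrow> (x, y') \<in> A \<Longrightarrow> y = y'" and "(0, 0) \<in> A"
    and "(x, y) \<in> A \<Longrightarrow> (x', y') \<in> A \<Longrightarrow> (x + x', y + y') \<in> A"
    and "(x, y) \<in> A \<Longrightarrow> (a *\<^sub>C x, a *\<^sub>C y) \<in> A"
  using assms unfolding linear_op_def single_valued_def by blast+

lemma linear_op_diff:
  assumes "linear_op A" "(x, y) \<in> A" "(x', y') \<in> A"
  shows "(x - x', y - y') \<in> A"
  using linear_opD(3)[OF assms(1,2) linear_opD(4)[OF assms(1,3), of "complex_of_real (-1)"]]
  unfolding scaleC_of_real by simp

lemma linear_op_subspace: "linear_op A \<Longrightarrow> subspace A"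
  unfolding subspace_def by (force simp: zero_prod_def linear_opD scaleC_of_real[symmetric])

text \<open>The graph also contains \<open>(\<i> *\<^sub>C x, \<i> *\<^sub>C w)\<close>, and the
  real equation there is the imaginary part of the complex one.\<close>

lemma op_adjoint_real:
  assumes "linear_op A"
  shows "op_adjoint A = {(y, z). \<forall>x w. (x, w) \<in> A \<longrightarrow> inner w y = inner x z}"
proof -
  have "cinner w y = cinner x z"
    if all: "\<And>x w. (x, w) \<in> A \<Longrightarrow> inner w y = inner x z" and xw: "(x, w) \<in> A" for x w y z
    using all[OF xw] all[OF linear_opD(4)[OF assms xw, of \<i>]]
    by (simp add: cinner_conv inner_scaleC_i)
  moreover have "cinner w y = cinner x z \<Longrightarrow> inner w y = inner x z" for x w y z :: 'a
    by (metis Re_cinner)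
  ultimately show ?thesis unfolding op_adjoint_def by blast
qed

lemma selfadjoint_opD:
  assumes "selfadjoint_op A"
  shows "linear_op A" "(x, w) \<in> A \<Longrightarrow> (y, z) \<in> A \<Longrightarrow> inner w y = inner x z"
    and "(\<And>x w. (x, w) \<in> A \<Longrightarrow> inner w y = inner x z) \<Longrightarrow> (y, z) \<in> A"
  using assms op_adjoint_real[of A] unfolding selfadjoint_op_def by blast+

lemma selfadjoint_op_closed:
  assumes "selfadjoint_op A"
  shows "closed A"
  unfolding closed_sequential_limits
proof (intro allI impI)
  fix f and l assume f: "(\<forall>n. f n \<in> A) \<and> f \<longlonglongrightarrow> l"
  have lim: "(\<lambda>n. fst (f n)) \<longlonglongrightarrow> fst l" "(\<lambda>n. snd (f n)) \<longlonglongrightarrow> snd l"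
    using f by (auto intro: tendsto_fst tendsto_snd)
  have "(fst l, snd l) \<in> A"
  proof (rule selfadjoint_opD(3)[OF assms])
    fix x w assume xw: "(x, w) \<in> A"
    have "inner w (fst (f n)) = inner x (snd (f n))" for n
      using selfadjoint_opD(2)[OF assms xw] f by (metis prod.collapse)
    then show "inner w (fst l) = inner x (snd l)"
      using LIMSEQ_unique[of "\<lambda>n. inner w (fst (f n))"] tendsto_inner[OF tendsto_const lim(1), of w]
        tendsto_inner[OF tendsto_const lim(2), of x] by simp
  qed
  then show "l \<in> A" by simp
qed

text \<open>The operator is \<open>P Q^(-1)\<close>. Symmetry of \<open>Q\<close> and
  \<open>P\<close> turns its adjoint into the set of pairs with \<open>P y = Q z\<close>;
  \<open>comm\<close> and \<open>max\<close> are the two inclusions between this set and the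
  graph.\<close>

lemma selfadjoint_op_graph:
  assumes Q: "clinear_sym Q" "inj (blinfun_apply Q)" and P: "clinear_sym P"
    and comm: "\<And>x. blinfun_apply Q (blinfun_apply P x) = blinfun_apply P (blinfun_apply Q x)"
    and max: "\<And>y z. blinfun_apply P y = blinfun_apply Q z
      \<Longrightarrow> \<exists>u. y = blinfun_apply Q u \<and> z = blinfun_apply P u"
  shows "selfadjoint_op {(blinfun_apply Q x, blinfun_apply P x) | x. True}" (is "selfadjoint_op ?A")
proof -
  have lin: "linear_op ?A"
    unfolding linear_op_def
  proof (intro conjI allI impI)
    show "single_valued ?A" using Q(2) by (auto intro!: single_valuedI simp: inj_eq)
    show "(0, 0) \<in> ?A" by (auto intro!: exI[of _ 0] simp: blinfun.zero_right)
    fix x y x' y' assume "(x, y) \<in> ?A" "(x', y') \<in> ?A"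
    then show "(x + x', y + y') \<in> ?A" by (auto simp: blinfun.add_right[symmetric])
  next
    fix a x y assume "(x, y) \<in> ?A"
    then show "(a *\<^sub>C x, a *\<^sub>C y) \<in> ?A"
      by (auto simp: clinear_sym_scaleC[OF Q(1), symmetric] clinear_sym_scaleC[OF P, symmetric])
  qed
  have dom: "Domain ?A = range (blinfun_apply Q)" by auto
  have "op_adjoint ?A = {(y, z). blinfun_apply P y = blinfun_apply Q z}"
  proof -
    have "(\<forall>x w. (x, w) \<in> ?A \<longrightarrow> inner w y = inner x z) \<longleftrightarrow> blinfun_apply P y = blinfun_apply Q z" for y z
    proof -
      have "(\<forall>x w. (x, w) \<in> ?A \<longrightarrow> inner w y = inner x z)
          \<longleftrightarrow> (\<forall>u. inner u (blinfun_apply P y) = inner u (blinfun_apply Q z))"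
        by (simp only: clinear_sym_inner[OF Q(1), symmetric] clinear_sym_inner[OF P, symmetric]) auto
      then show ?thesis using vector_eq_ldot by blast
    qed
    then show ?thesis unfolding op_adjoint_real[OF lin] by simp
  qed
  also have "\<dots> = ?A" using max comm by auto
  finally show ?thesis
    unfolding selfadjoint_op_def using lin dense_range_sym[OF Q] dom by simp
qed

lemma positive_selfadjoint_inverse:
  assumes Z: "clinear_sym Z" "inj (blinfun_apply Z)" and pos: "\<And>x. 0 \<le> inner x (blinfun_apply Z x)"
  shows "positive_selfadjoint_op {(blinfun_apply Z x, x) | x. True}"
proof -
  have "clinear_sym (id_blinfun :: 'a \<Rightarrow>\<^sub>L 'a)" by (rule clinear_symI) simp_all
  from selfadjoint_op_graph[OF Z this]
  show ?thesis unfolding positive_selfadjoint_op_def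
    using pos by (auto simp: Re_cinner inner_commute)
qed

text \<open>Here \<open>R\<close> is \<open>(A + 1)^(-1)\<close>. Positivity bounds
  \<open>A + 1\<close> from below by 1, so its range \<open>M\<close> is closed because the graph
  is; self-adjointness makes \<open>M\<close> dense. Both norm bounds are recorded because square
  roots of \<open>R\<close> and of \<open>1 - R\<close> are taken later.\<close>

lemma positive_selfadjoint_resolvent:
  assumes A: "positive_selfadjoint_op A"
  obtains R where "clinear_sym R" "inj (blinfun_apply R)" "norm (id_blinfun - R) \<le> 1" "norm R \<le> 1"
    "A = {(blinfun_apply R x, x - blinfun_apply R x) | x. True}"
proof -
  have sa: "selfadjoint_op A" and pos: "\<And>x y. (x, y) \<in> A \<Longrightarrow> 0 \<le> inner x y"
    using A unfolding positive_selfadjoint_op_def Re_cinner by auto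
  note lin = selfadjoint_opD(1)[OF sa]
  have low: "norm x \<le> norm (y + x)" if "(x, y) \<in> A" for x y
  proof -
    have "(norm x)\<^sup>2 \<le> inner x (y + x)"
      using pos[OF that] by (simp add: inner_add_right power2_norm_eq_inner)
    then have "norm x * norm x \<le> norm x * norm (y + x)"
      using norm_cauchy_schwarz[of x "y + x"] by (simp add: power2_eq_square)
    then show ?thesis by (cases "x = 0") auto
  qed
  define M where "M = (\<lambda>(x, y). y + x) ` A"
  have "subspace M"
    unfolding M_def
    by (rule linear_subspace_image[OF _ linear_op_subspace[OF lin]])
      (auto intro!: linearI simp: algebra_simps)
  moreover have "closed M"
    unfolding closed_sequential_limits
  proof (intro allI impI)
    fix f l assume f: "(\<forall>n. f n \<in> M) \<and> f \<longlonglongrightarrow> l"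
    then have "\<forall>n. \<exists>x. (x, f n - x) \<in> A" unfolding M_def image_iff Bex_def by (auto simp: algebra_simps) (metis add_diff_cancel_left')
    then obtain x where x: "\<And>n. (x n, f n - x n) \<in> A" by metis
    have d: "norm (x m - x n) \<le> norm (f m - f n)" for m n
      using low[OF linear_op_diff[OF lin x x], of m n] by simp
    have "Cauchy x"
    proof (rule metric_CauchyI)
      fix e :: real assume "e > 0"
      moreover have "Cauchy f" using f LIMSEQ_imp_Cauchy by blast
      ultimately obtain N where "\<forall>m\<ge>N. \<forall>n\<ge>N. dist (f m) (f n) < e" using metric_CauchyD by metis
      then show "\<exists>N. \<forall>m\<ge>N. \<forall>n\<ge>N. dist (x m) (x n) < e"
        by (metis d dist_norm order_le_less_trans)
    qed
    then obtain p where p: "x \<longlonglongrightarrow> p" using Cauchy_convergent_iff convergent_def by blast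
    have "(\<lambda>n. (x n, f n - x n)) \<longlonglongrightarrow> (p, l - p)" using f p by (intro tendsto_intros) auto
    then have "(p, l - p) \<in> A"
      by (rule closed_sequentially[OF selfadjoint_op_closed[OF sa] x])
    then show "l \<in> M" unfolding M_def by force
  qed
  moreover have "z = 0" if z: "\<And>y. y \<in> M \<Longrightarrow> inner z y = 0" for z
  proof -
    \<comment> \<open>Orthogonality to the range of \<open>A + 1\<close> says that
      \<open>A z = - z\<close> in the sense of the adjoint; positivity then forces
      \<open>z = 0\<close>.\<close>
    have "(z, - z) \<in> A"
    proof (rule selfadjoint_opD(3)[OF sa])
      fix x w assume "(x, w) \<in> A"
      then have "inner z (w + x) = 0" using z unfolding M_def by force
      then show "inner w z = inner x (- z)" by (simp add: inner_add_right inner_commute)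
    qed
    from pos[OF this] show "z = 0" by (metis inner_gt_zero_iff inner_minus_right neg_0_le_iff_le not_le)
  qed
  ultimately have "M = UNIV" using subspace_dense[of M] closure_closed[of M] by auto
  then have ex: "\<exists>x. (x, u - x) \<in> A" for u
  proof -
    have "u \<in> M" using \<open>M = UNIV\<close> by simp
    then obtain x y where "(x, y) \<in> A" "u = y + x" unfolding M_def by auto
    then show ?thesis by (intro exI[of _ x]) simp
  qed
  have uniq: "x = x'" if "(x, u - x) \<in> A" "(x', u - x') \<in> A" for x x' u
    using low[OF linear_op_diff[OF lin that]] by simp
  define r where "r u = (SOME x. (x, u - x) \<in> A)" for u
  have r: "(r u, u - r u) \<in> A" for u
    unfolding r_def by (rule someI_ex[OF ex])
  have rI: "r u = x" if "(x, u - x) \<in> A" for u x using uniq[OF r that] .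
  have nr: "norm (r u) \<le> norm u * 1" for u using low[OF r] by simp
  have bl: "bounded_linear r"
  proof (rule bounded_linear_intro[OF _ _ nr])
    fix u v
    show "r (u + v) = r u + r v"
      by (rule rI) (use linear_opD(3)[OF lin r r, of u v] in \<open>simp add: algebra_simps\<close>)
    show "r (c *\<^sub>R u) = c *\<^sub>R r u" for c
      by (rule rI) (use linear_opD(4)[OF lin r, of "complex_of_real c" u] in
        \<open>simp add: scaleC_of_real algebra_simps\<close>)
  qed
  note app = bounded_linear_Blinfun_apply[OF bl]
  show ?thesis
  proof
    show "clinear_sym (Blinfun r)"
    proof (rule clinear_symI; unfold app)
      fix u v
      show "r (\<i> *\<^sub>C u) = \<i> *\<^sub>C r u"
        by (rule rI) (use linear_opD(4)[OF lin r, of \<i> u] in \<open>simp add: scaleC_diff_right\<close>)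
      show "inner (r u) v = inner u (r v)"
        using selfadjoint_opD(2)[OF sa r[of u] r[of v]] by (simp add: inner_diff_left inner_diff_right)
    qed
    show "inj (blinfun_apply (Blinfun r))"
      unfolding app
    proof (rule injI)
      fix u v assume "r u = r v"
      then have "u - r u = v - r v" using linear_opD(1)[OF lin r[of u]] r[of v] by metis
      then show "u = v" using \<open>r u = r v\<close> by simp
    qed
    show "norm (Blinfun r) \<le> 1" by (rule norm_blinfun_bound) (use nr in \<open>simp_all add: app\<close>)
    show "norm (id_blinfun - Blinfun r) \<le> 1"
    proof (rule norm_blinfun_bound)
      fix u
      \<comment> \<open>The mixed term is nonnegative because \<open>u - r u\<close> is the image of
        \<open>r u\<close> under \<open>A\<close>.\<close>
      have "(norm (u - r u))\<^sup>2 + (norm (r u))\<^sup>2 + 2 * inner (r u) (u - r u) = (norm u)\<^sup>2"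
        by (simp add: power2_norm_eq_inner inner_diff_left inner_diff_right inner_commute)
      then have "(norm (u - r u))\<^sup>2 \<le> (norm u)\<^sup>2"
        using pos[OF r[of u]] zero_le_power2[of "norm (r u)"] by linarith
      then have "norm (u - r u) \<le> norm u" by (rule power2_le_imp_le) simp
      then show "norm (blinfun_apply (id_blinfun - Blinfun r) u) \<le> 1 * norm u"
        by (simp add: blinfun.diff_left app)
    qed simp
    show "A = {(blinfun_apply (Blinfun r) x, x - blinfun_apply (Blinfun r) x) | x. True}"
      unfolding app
    proof (intro equalityI subsetI)
      fix p assume "p \<in> A"
      then obtain x y where p: "p = (x, y)" "(x, y) \<in> A" by (cases p) auto
      have "r (y + x) = x" by (rule rI) (use p in simp)
      then have "p = (r (y + x), y + x - r (y + x))" using p by simp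
      then show "p \<in> {(r x, x - r x) | x. True}" by blast
    qed (use r in auto)
  qed
qed

text \<open>Since \<open>A\<close> is \<open>(1 - R) R^(-1)\<close>, its root should be
  \<open>P Q^(-1)\<close> with \<open>Q Q = R\<close> and \<open>P P = 1 - R\<close>. All these
  operators commute, because each root commutes with whatever commutes with its square.\<close>

lemma exists_op_sqrt:
  assumes A: "positive_selfadjoint_op A"
  shows "\<exists>S. positive_selfadjoint_op S \<and> S O S = A"
proof -
  obtain R where R: "clinear_sym R" "inj (blinfun_apply R)" "norm (id_blinfun - R) \<le> 1" "norm R \<le> 1"
    "A = {(blinfun_apply R x, x - blinfun_apply R x) | x. True}"
    using positive_selfadjoint_resolvent[OF A] .
  obtain Q where Q: "clinear_sym Q" "Q o\<^sub>L Q = R" "norm (id_blinfun - Q) \<le> 1"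
    "\<And>Z. Z o\<^sub>L R = R o\<^sub>L Z \<Longrightarrow> Z o\<^sub>L Q = Q o\<^sub>L Z"
    using exists_bounded_sqrt[OF R(1,3)] by metis
  have idc: "Z o\<^sub>L id_blinfun = Z" "id_blinfun o\<^sub>L Z = Z" for Z :: "'a \<Rightarrow>\<^sub>L 'a" by (auto intro: blinfun_eqI)
  have symR: "clinear_sym (id_blinfun - R)"
    using R(1) by (intro clinear_symI) (simp_all add: blinfun.diff_left clinear_sym_scaleC
        clinear_sym_inner inner_diff_left inner_diff_right scaleC_diff_right)
  have nR: "norm (id_blinfun - (id_blinfun - R)) \<le> 1" using R(4) by simp
  obtain P where P: "clinear_sym P" "P o\<^sub>L P = id_blinfun - R" "norm (id_blinfun - P) \<le> 1"
    "\<And>Z. Z o\<^sub>L (id_blinfun - R) = (id_blinfun - R) o\<^sub>L Z \<Longrightarrow> Z o\<^sub>L P = P o\<^sub>L Z"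
    using exists_bounded_sqrt[OF symR nR] by blast
  have QR: "Q o\<^sub>L R = R o\<^sub>L Q" unfolding Q(2)[symmetric] by (rule blinfun_compose_assoc[symmetric])
  have QP: "Q o\<^sub>L P = P o\<^sub>L Q"
    by (rule P(4)) (simp add: blinfun_compose_diff_left blinfun_compose_diff_right idc QR)
  \<comment> \<open>A fourth root of \<open>R\<close>: it commutes with \<open>P\<close> and so
    turns \<open>inner (Q u) (P u)\<close> into the form of \<open>P\<close> at \<open>q u\<close>,
    which is nonnegative.\<close>
  obtain q where q: "clinear_sym q" "q o\<^sub>L q = Q"
    "\<And>Z. Z o\<^sub>L Q = Q o\<^sub>L Z \<Longrightarrow> Z o\<^sub>L q = q o\<^sub>L Z"
    using exists_bounded_sqrt[OF Q(1,3)] by metis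
  have PQ': "P o\<^sub>L q = q o\<^sub>L P" by (rule q(3)) (simp add: QP)
  have QQ: "blinfun_apply Q (blinfun_apply Q x) = blinfun_apply R x" for x
    using Q(2) by (metis blinfun_apply_blinfun_compose)
  have PP: "blinfun_apply P (blinfun_apply P x) = x - blinfun_apply R x" for x
    using arg_cong[OF P(2), of "\<lambda>Z. blinfun_apply Z x"] by (simp add: blinfun.diff_left)
  have QPx: "blinfun_apply Q (blinfun_apply P x) = blinfun_apply P (blinfun_apply Q x)" for x
    using QP by (metis blinfun_apply_blinfun_compose)
  have injQ: "inj (blinfun_apply Q)" using R(2) QQ by (metis injD injI)
  \<comment> \<open>The witness \<open>u = Q y + P z\<close> comes from
    \<open>Q Q + P P = 1\<close>: if \<open>y = Q u\<close> and \<open>z = P u\<close>, then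
    \<open>Q y + P z = u\<close>.\<close>
  have max: "\<exists>u. y = blinfun_apply Q u \<and> z = blinfun_apply P u"
    if yz: "blinfun_apply P y = blinfun_apply Q z" for y z
  proof (intro exI conjI)
    show "y = blinfun_apply Q (blinfun_apply Q y + blinfun_apply P z)"
      by (simp add: blinfun.add_right QQ QPx PP flip: yz)
    show "z = blinfun_apply P (blinfun_apply Q y + blinfun_apply P z)"
      by (simp add: blinfun.add_right PP yz QQ flip: QPx)
  qed
  define S where "S = {(blinfun_apply Q x, blinfun_apply P x) | x. True}"
  have "positive_selfadjoint_op S"
    unfolding positive_selfadjoint_op_def
  proof (intro conjI allI impI)
    show "selfadjoint_op S"
      unfolding S_def by (rule selfadjoint_op_graph[OF Q(1) injQ P(1) QPx max])
    fix x y assume "(x, y) \<in> S"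
    then obtain u where u: "x = blinfun_apply Q u" "y = blinfun_apply P u" unfolding S_def by auto
    have "inner x y = inner (blinfun_apply q u) (blinfun_apply P (blinfun_apply q u))"
      using q(1,2) PQ' u by (metis blinfun_apply_blinfun_compose clinear_sym_inner)
    then show "0 \<le> Re (cinner x y)"
      using inner_nonneg_if_near_id[OF P(3)] by (simp add: Re_cinner)
  qed
  moreover have "S O S = A"
  proof (intro equalityI subsetI)
    fix p assume "p \<in> S O S"
    then obtain x w where p: "p = (blinfun_apply Q x, blinfun_apply P w)"
      and xw: "blinfun_apply P x = blinfun_apply Q w" unfolding S_def by auto
    obtain u where "x = blinfun_apply Q u" "w = blinfun_apply P u" using max[OF xw] by auto
    then show "p \<in> A" using p by (auto simp: R(5) QQ PP)
  next
    fix p assume "p \<in> A"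
    then obtain u where p: "p = (blinfun_apply R u, u - blinfun_apply R u)" using R(5) by auto
    have "(blinfun_apply Q (blinfun_apply Q u), blinfun_apply P (blinfun_apply Q u)) \<in> S"
      "(blinfun_apply Q (blinfun_apply P u), blinfun_apply P (blinfun_apply P u)) \<in> S"
      unfolding S_def by blast+
    then show "p \<in> S O S" unfolding p QQ PP QPx by blast
  qed
  ultimately show ?thesis by blast
qed

lemma op_sqrt:
  assumes "positive_selfadjoint_op A"
  shows "positive_selfadjoint_op (op_sqrt A)" "op_sqrt A O op_sqrt A = A"
  using someI_ex[OF exists_op_sqrt[OF assms]] unfolding op_sqrt_def by blast+

text \<open>Let \<open>G\<close> be the chosen root. As \<open>G O G\<close> is injective and onto,
  so is \<open>G\<close>; its inverse \<open>g\<close> is symmetric with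
  \<open>g (g u) = Z u\<close>. Hence \<open>(norm (g u))\<^sup>2 = inner u (Z u)\<close>, which
  makes \<open>g\<close> bounded.\<close>

lemma op_sqrt_bounded_inverse:
  assumes Z: "clinear_sym Z" "inj (blinfun_apply Z)" and pos: "\<And>x. 0 \<le> inner x (blinfun_apply Z x)"
  obtains Q where "clinear_sym Q" "inj (blinfun_apply Q)" "Q o\<^sub>L Q = Z"
    "op_sqrt {(blinfun_apply Z x, x) | x. True} = {(blinfun_apply Q x, x) | x. True}"
proof -
  define G where "G = op_sqrt {(blinfun_apply Z x, x) | x. True}"
  have G: "positive_selfadjoint_op G" "G O G = {(blinfun_apply Z x, x) | x. True}"
    using op_sqrt[OF positive_selfadjoint_inverse[OF assms]] G_def by auto
  have sa: "selfadjoint_op G" using G(1) positive_selfadjoint_op_def by blast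
  note lin = selfadjoint_opD(1)[OF sa]
  have inj: "x = 0" if "(x, 0) \<in> G" for x
  proof -
    have "(x, 0) \<in> G O G" using that linear_opD(2)[OF lin] by blast
    then show ?thesis unfolding G(2) by (auto simp: blinfun.zero_right)
  qed
  have "\<exists>x. (x, u) \<in> G" for u
  proof -
    have "(blinfun_apply Z u, u) \<in> G O G" unfolding G(2) by blast
    then show ?thesis by blast
  qed
  then obtain g where g: "\<And>u. (g u, u) \<in> G" by metis
  have gI: "g u = x" if "(x, u) \<in> G" for u x
    using inj[of "g u - x"] linear_op_diff[OF lin g[of u] that] by simp
  have gg: "g (g u) = blinfun_apply Z u" for u
  proof -
    have "(g (g u), u) \<in> G O G" using g by blast
    then show ?thesis unfolding G(2) by auto
  qed
  have sym: "inner (g u) v = inner u (g v)" for u v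
    using selfadjoint_opD(2)[OF sa g[of u] g[of v]] by (simp add: inner_commute)
  have ng: "norm (g u) \<le> norm u * sqrt (norm Z)" for u
  proof -
    have "(norm (g u))\<^sup>2 = inner u (blinfun_apply Z u)"
      by (simp add: power2_norm_eq_inner sym gg)
    also have "\<dots> \<le> norm u * (norm Z * norm u)"
      by (meson norm_blinfun norm_cauchy_schwarz mult_left_mono norm_ge_zero order_trans)
    also have "\<dots> = (norm u * sqrt (norm Z))\<^sup>2" by (simp add: power_mult_distrib power2_eq_square)
    finally show ?thesis by (rule power2_le_imp_le) simp
  qed
  have bl: "bounded_linear g"
  proof (rule bounded_linear_intro[OF _ _ ng])
    show "g (u + v) = g u + g v" for u v by (rule gI[OF linear_opD(3)[OF lin g g]])
    show "g (c *\<^sub>R u) = c *\<^sub>R g u" for c u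
      using gI[OF linear_opD(4)[OF lin g, of "complex_of_real c" u]] by (simp add: scaleC_of_real)
  qed
  note app = bounded_linear_Blinfun_apply[OF bl]
  show ?thesis
  proof
    show "clinear_sym (Blinfun g)"
      by (rule clinear_symI; unfold app) (use gI[OF linear_opD(4)[OF lin g]] sym in auto)
    show "inj (blinfun_apply (Blinfun g))"
      unfolding app using gg Z(2) by (metis injD injI)
    show "Blinfun g o\<^sub>L Blinfun g = Z" by (rule blinfun_eqI) (simp add: app gg)
    have "G = {(g x, x) | x. True}" using g gI by auto
    then show "op_sqrt {(blinfun_apply Z x, x) | x. True} = {(blinfun_apply (Blinfun g) x, x) | x. True}"
      unfolding app G_def .
  qed
qed


section \<open>The scale of spaces\<close>

text \<open>The domain of \<open>S O S\<close> is a core of \<open>S\<close>. Let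
  \<open>(a, b)\<close> be the part of \<open>p\<close> orthogonal, in the product space, to the
  graph over that domain. For \<open>x\<close> there with \<open>S x = w\<close> and
  \<open>S w = y\<close>, symmetry turns \<open>inner a x + inner b w = 0\<close> into
  \<open>inner a (x + y) = 0\<close>, and \<open>surj\<close> provides an \<open>x\<close> with
  \<open>x + y = a\<close>.\<close>

lemma selfadjoint_op_core:
  assumes S: "selfadjoint_op S"
    and surj: "\<And>u. \<exists>x w y. (x, w) \<in> S \<and> (w, y) \<in> S \<and> u = y + x"
    and "p \<in> S"
  shows "p \<in> closure {(x, w). (x, w) \<in> S \<and> w \<in> Domain S}"
proof -
  note lin = selfadjoint_opD(1)[OF S]
  define M where "M = {(x, w). (x, w) \<in> S \<and> w \<in> Domain S}"
  have "subspace M"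
    unfolding subspace_def
  proof (intro conjI ballI allI)
    show "0 \<in> M" using linear_opD(2)[OF lin] unfolding M_def zero_prod_def by blast
    fix u assume u: "u \<in> M"
    show "c *\<^sub>R u \<in> M" for c
      using u linear_opD(4)[OF lin, of _ _ "complex_of_real c"]
      unfolding M_def scaleC_of_real by fastforce
    fix v assume "v \<in> M"
    then show "u + v \<in> M" using u linear_opD(3)[OF lin] unfolding M_def by fastforce
  qed
  then obtain q where q: "q \<in> closure M" "\<And>v. v \<in> closure M \<Longrightarrow> inner (p - q) v = 0"
    using exists_orthogonal_projection[OF subspace_closure closed_closure, of M p] by metis
  have "closure M \<subseteq> S"
    by (rule closure_minimal[OF _ selfadjoint_op_closed[OF S]]) (auto simp: M_def)
  then have "q \<in> S" using q(1) by blast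
  then have pq: "p - q \<in> S" using \<open>p \<in> S\<close> subspace_diff[OF linear_op_subspace[OF lin]] by blast
  obtain a b where ab: "p - q = (a, b)" by (cases "p - q") auto
  have abS: "(a, b) \<in> S" using pq ab by simp
  obtain x w y where xwy: "(x, w) \<in> S" "(w, y) \<in> S" "a = y + x" using surj by blast
  have "(x, w) \<in> closure M" using xwy closure_subset unfolding M_def by fastforce
  then have "inner a x + inner b w = 0" using q(2) ab by (metis inner_Pair)
  then have "inner a a = 0"
    using selfadjoint_opD(2)[OF S abS xwy(2)] xwy(3) by (simp add: inner_add_right)
  then have "a = 0" by simp
  then have "b = 0" using linear_opD(1)[OF lin _ linear_opD(2)[OF lin]] abS by blast
  then have "p = q" using ab \<open>a = 0\<close> by (simp flip: zero_prod_def)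
  then show ?thesis using q(1) unfolding M_def by simp
qed

section \<open>The form domain and the completion in coordinates\<close>

lemma Cauchy_dist_le:
  assumes "Cauchy f" "\<And>m n. dist (g m) (g n) \<le> dist (f m) (f n)"
  shows "Cauchy g"
proof (rule metric_CauchyI)
  fix e :: real assume "e > 0"
  then obtain N where "\<forall>m\<ge>N. \<forall>n\<ge>N. dist (f m) (f n) < e" using metric_CauchyD[OF assms(1)] by metis
  then show "\<exists>N. \<forall>m\<ge>N. \<forall>n\<ge>N. dist (g m) (g n) < e"
    by (metis assms(2) order_le_less_trans)
qed

text \<open>
  Both square roots are determined by their restrictions to \<open>Domain A\<close>, where their graph norms
  agree; this identifies \<open>Hplus A\<close> with the domain of \<open>op_sqrt (op_plus_one A)\<close>.
\<close>

lemma Hplus_conv: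
  assumes A: "positive_selfadjoint_op A"
  obtains Q where "clinear_sym Q" "inj (blinfun_apply Q)" "Hplus A = range (blinfun_apply Q)"
    "op_sqrt (op_plus_one A) = {(blinfun_apply Q x, x) | x. True}"
    "A = {(blinfun_apply Q (blinfun_apply Q x), x - blinfun_apply Q (blinfun_apply Q x)) | x. True}"
    "\<And>x. norm (x - blinfun_apply Q (blinfun_apply Q x)) \<le> norm x"
proof -
  obtain R where R: "clinear_sym R" "inj (blinfun_apply R)" "norm (id_blinfun - R) \<le> 1" "norm R \<le> 1"
    "A = {(blinfun_apply R x, x - blinfun_apply R x) | x. True}"
    using positive_selfadjoint_resolvent[OF A] .
  have plus: "op_plus_one A = {(blinfun_apply R x, x) | x. True}"
    unfolding op_plus_one_def R(5) by force
  obtain Q where Q: "clinear_sym Q" "inj (blinfun_apply Q)" "Q o\<^sub>L Q = R"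
    "op_sqrt {(blinfun_apply R x, x) | x. True} = {(blinfun_apply Q x, x) | x. True}"
    using op_sqrt_bounded_inverse[OF R(1,2) inner_nonneg_if_near_id[OF R(3)]] .
  have QQ: "blinfun_apply Q (blinfun_apply Q x) = blinfun_apply R x" for x
    using Q(3) by (metis blinfun_apply_blinfun_compose)
  define W where "W = op_sqrt A"
  have W: "selfadjoint_op W" and WW: "W O W = A"
    using op_sqrt[OF A] unfolding W_def positive_selfadjoint_op_def by auto
  note lin = selfadjoint_opD(1)[OF W]
  \<comment> \<open>For \<open>x = Q (Q u)\<close> the vector \<open>Q u\<close> is
    \<open>(A + 1)^(1/2) x\<close>, so this equates the plus norm of \<open>x\<close> with its graph
    norm for \<open>W\<close>.\<close>
  have normQ: "\<exists>u. x = blinfun_apply Q (blinfun_apply Q u) \<and> (norm (blinfun_apply Q u))\<^sup>2 = (norm x)\<^sup>2 + (norm w)\<^sup>2"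
    if xw: "(x, w) \<in> W" and w: "w \<in> Domain W" for x w
  proof -
    obtain y where y: "(w, y) \<in> W" using w by blast
    then have "(x, y) \<in> A" using xw WW by blast
    then obtain u where u: "x = blinfun_apply R u" "y = u - blinfun_apply R u" using R(5) by auto
    have "inner w w = inner x y" using selfadjoint_opD(2)[OF W xw y] .
    moreover have "inner (blinfun_apply Q u) (blinfun_apply Q u) = inner u (blinfun_apply R u)"
      by (simp add: clinear_sym_inner[OF Q(1)] QQ)
    ultimately have "(norm (blinfun_apply Q u))\<^sup>2 = (norm x)\<^sup>2 + (norm w)\<^sup>2"
      unfolding power2_norm_eq_inner using u by (simp add: inner_diff_right inner_commute)
    then show ?thesis using u QQ by metis
  qed
  \<comment> \<open>The surjectivity asked for is that of \<open>W O W\<close> plus the identity,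
    that is of \<open>A + 1\<close>, with preimages given by \<open>R\<close>.\<close>
  have core: "p \<in> closure {(x, w). (x, w) \<in> W \<and> w \<in> Domain W}" if "p \<in> W" for p
  proof (rule selfadjoint_op_core[OF W _ that])
    fix u
    have "(blinfun_apply R u, u - blinfun_apply R u) \<in> W O W" unfolding WW R(5) by blast
    then obtain w where "(blinfun_apply R u, w) \<in> W" "(w, u - blinfun_apply R u) \<in> W" by blast
    then show "\<exists>x w y. (x, w) \<in> W \<and> (w, y) \<in> W \<and> u = y + x" by force
  qed
  \<comment> \<open>Approximate in graph norm from the core. By \<open>normQ\<close> the preimages
    under \<open>Q\<close> of the first components are at the same mutual distances as the graph
    points, so they converge, and \<open>Q\<close> is continuous.\<close>
  have "Domain W \<subseteq> range (blinfun_apply Q)"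
  proof
    fix x assume "x \<in> Domain W"
    then obtain w where "(x, w) \<in> W" by blast
    from core[OF this] obtain f
      where f: "\<And>n. f n \<in> {(x, w). (x, w) \<in> W \<and> w \<in> Domain W}" "f \<longlonglongrightarrow> (x, w)"
      unfolding closure_sequential by blast
    have fW: "(fst (f n), snd (f n)) \<in> W" "snd (f n) \<in> Domain W" for n
      using f(1)[of n] by auto
    have "\<forall>n. \<exists>v. fst (f n) = blinfun_apply Q v"
    proof
      fix n
      obtain u where "fst (f n) = blinfun_apply Q (blinfun_apply Q u)" using normQ[OF fW[of n]] by auto
      then show "\<exists>v. fst (f n) = blinfun_apply Q v" ..
    qed
    from choice[OF this] obtain v where v: "\<And>n. fst (f n) = blinfun_apply Q (v n)" by auto
    have "dist (v m) (v n) \<le> dist (f m) (f n)" for m n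
    proof -
      have "(fst (f m) - fst (f n), snd (f m) - snd (f n)) \<in> W"
        by (rule linear_op_diff[OF lin fW(1) fW(1)])
      moreover have "snd (f m) - snd (f n) \<in> Domain W"
        using fW(2) linear_op_diff[OF lin] by blast
      ultimately obtain u where u: "fst (f m) - fst (f n) = blinfun_apply Q (blinfun_apply Q u)"
        "(norm (blinfun_apply Q u))\<^sup>2 = (norm (fst (f m) - fst (f n)))\<^sup>2 + (norm (snd (f m) - snd (f n)))\<^sup>2"
        using normQ by blast
      have "blinfun_apply Q (v m - v n) = blinfun_apply Q (blinfun_apply Q u)"
        using u(1) v by (simp add: blinfun.diff_right)
      then have "v m - v n = blinfun_apply Q u" using Q(2) by (meson injD)
      then have "(dist (v m) (v n))\<^sup>2 = (dist (f m) (f n))\<^sup>2"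
        using u(2) by (simp add: dist_norm norm_prod_def)
      then show ?thesis by (simp add: power2_eq_iff_nonneg)
    qed
    then have "Cauchy v" using Cauchy_dist_le LIMSEQ_imp_Cauchy[OF f(2)] by blast
    then obtain l where "v \<longlonglongrightarrow> l" using Cauchy_convergent_iff convergent_def by blast
    then have "(\<lambda>n. fst (f n)) \<longlonglongrightarrow> blinfun_apply Q l" unfolding v by (intro tendsto_intros)
    then have "x = blinfun_apply Q l" using tendsto_fst[OF f(2)] LIMSEQ_unique by fastforce
    then show "x \<in> range (blinfun_apply Q)" by blast
  qed
  \<comment> \<open>Conversely, approximate \<open>v\<close> by vectors \<open>Q u\<close>: then
    \<open>Q (Q u)\<close> lies in the domain of \<open>A\<close>, the images under \<open>W\<close>
    are Cauchy by \<open>normQ\<close>, and \<open>W\<close> is closed.\<close>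
  moreover have "range (blinfun_apply Q) \<subseteq> Domain W"
  proof
    fix x assume "x \<in> range (blinfun_apply Q)"
    then obtain v where v: "x = blinfun_apply Q v" by blast
    have "v \<in> closure (range (blinfun_apply Q))" using dense_range_sym[OF Q(1,2)] by simp
    then obtain g where g: "\<And>n. g n \<in> range (blinfun_apply Q)" "g \<longlonglongrightarrow> v"
      by (auto simp: closure_sequential)
    have "\<forall>n. \<exists>w. (blinfun_apply Q (g n), w) \<in> W \<and> w \<in> Domain W"
    proof
      fix n
      obtain u where u: "g n = blinfun_apply Q u" using g(1) by blast
      have "(blinfun_apply R u, u - blinfun_apply R u) \<in> W O W" unfolding WW R(5) by blast
      then show "\<exists>w. (blinfun_apply Q (g n), w) \<in> W \<and> w \<in> Domain W" unfolding u QQ by blast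
    qed
    from choice[OF this] obtain w
      where w: "\<And>n. (blinfun_apply Q (g n), w n) \<in> W" "\<And>n. w n \<in> Domain W" by auto
    have "dist (w m) (w n) \<le> dist (g m) (g n)" for m n
    proof -
      have "(blinfun_apply Q (g m) - blinfun_apply Q (g n), w m - w n) \<in> W"
        by (rule linear_op_diff[OF lin w(1) w(1)])
      moreover have "w m - w n \<in> Domain W"
        using w(2) linear_op_diff[OF lin] by blast
      ultimately obtain u where u: "blinfun_apply Q (g m) - blinfun_apply Q (g n) = blinfun_apply Q (blinfun_apply Q u)"
        "(norm (blinfun_apply Q u))\<^sup>2 = (norm (blinfun_apply Q (g m) - blinfun_apply Q (g n)))\<^sup>2 + (norm (w m - w n))\<^sup>2"
        using normQ by blast
      have "blinfun_apply Q (g m - g n) = blinfun_apply Q (blinfun_apply Q u)"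
        using u(1) by (simp add: blinfun.diff_right)
      then have "g m - g n = blinfun_apply Q u" using Q(2) by (meson injD)
      then have "(norm (w m - w n))\<^sup>2 \<le> (norm (g m - g n))\<^sup>2" using u(2) by simp
      then show ?thesis unfolding dist_norm by (rule power2_le_imp_le) simp
    qed
    then have "Cauchy w" using Cauchy_dist_le LIMSEQ_imp_Cauchy[OF g(2)] by blast
    then obtain l where l: "w \<longlonglongrightarrow> l" using Cauchy_convergent_iff convergent_def by blast
    have "(\<lambda>n. (blinfun_apply Q (g n), w n)) \<longlonglongrightarrow> (x, l)"
      unfolding v by (intro tendsto_intros g l)
    then have "(x, l) \<in> W"
      by (rule closed_sequentially[OF selfadjoint_op_closed[OF W] w(1)])
    then show "x \<in> Domain W" by blast
  qed
  ultimately have "Hplus A = range (blinfun_apply Q)" unfolding Hplus_def W_def by blast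
  moreover have "norm (x - blinfun_apply R x) \<le> norm x" for x
    using norm_blinfun[of "id_blinfun - R" x] mult_right_mono[OF R(3), of "norm x"]
    by (simp add: blinfun.diff_left)
  ultimately show ?thesis using that[OF Q(1,2)] Q(4) R(5) unfolding plus QQ by blast
qed

text \<open>The map taking \<open>\<iota> x\<close> to \<open>Q x\<close> is isometric on a dense
  subspace, so it extends. The range of the extension is closed, as an isometric image of a complete
  space, and contains the dense range of \<open>Q\<close>.\<close>

lemma minus_completion_unitary:
  fixes \<iota> :: "'h::complex_hilbert \<Rightarrow> 'm::complex_hilbert" and Q :: "'h \<Rightarrow>\<^sub>L 'h"
  assumes lin: "clinear_on UNIV \<iota>" and iso: "\<And>x. norm (\<iota> x) = norm (blinfun_apply Q x)"
    and dense: "closure (range \<iota>) = UNIV"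
    and Q: "clinear_sym Q" "inj (blinfun_apply Q)"
  obtains U where "\<And>x. blinfun_apply U (\<iota> x) = blinfun_apply Q x"
    "\<And>m. norm (blinfun_apply U m) = norm m" "surj (blinfun_apply U)"
    "\<And>a m. blinfun_apply U (a *\<^sub>C m) = a *\<^sub>C blinfun_apply U m"
proof -
  have add: "\<iota> (x + y) = \<iota> x + \<iota> y" and scale: "\<iota> (a *\<^sub>C x) = a *\<^sub>C \<iota> x" for x y a
    using lin unfolding clinear_on_def by auto
  have "linear \<iota>"
    by (rule linearI) (metis add, metis scale scaleC_of_real)
  then have diff: "\<iota> (x - y) = \<iota> x - \<iota> y" for x y by (rule linear_diff)
  have dist: "dist (\<iota> x) (\<iota> y) = dist (blinfun_apply Q x) (blinfun_apply Q y)" for x y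
    unfolding dist_norm diff[symmetric] blinfun.diff_right[symmetric] by (rule iso)
  have "inj \<iota>"
  proof (rule injI)
    fix x y assume "\<iota> x = \<iota> y"
    then have "blinfun_apply Q x = blinfun_apply Q y" using dist[of x y] by simp
    then show "x = y" using Q(2) by (simp only: inj_eq)
  qed
  define f where "f m = blinfun_apply Q (inv \<iota> m)" for m
  have f: "f (\<iota> x) = blinfun_apply Q x" for x unfolding f_def by (simp add: \<open>inj \<iota>\<close>)
  have uc: "uniformly_continuous_on (range \<iota>) f"
    unfolding uniformly_continuous_on_def
  proof (intro allI impI)
    fix e :: real assume "e > 0"
    moreover have "dist (f m') (f m) = dist m' m" if "m \<in> range \<iota>" "m' \<in> range \<iota>" for m m'
      using that f dist by force
    ultimately show "\<exists>d>0. \<forall>m\<in>range \<iota>. \<forall>m'\<in>range \<iota>. dist m' m < d \<longrightarrow> dist (f m') (f m) < e"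
      by auto
  qed
  obtain g where g: "uniformly_continuous_on (closure (range \<iota>)) g"
      "\<And>m. m \<in> range \<iota> \<Longrightarrow> f m = g m"
    by (rule uniformly_continuous_on_extension_on_closure[OF uc]) (rule that)
  have g_iota: "g (\<iota> x) = blinfun_apply Q x" for x using g(2)[of "\<iota> x"] f by simp
  have cont: "continuous_on UNIV g"
    using uniformly_continuous_imp_continuous[OF g(1)] unfolding dense .
  have lim: "(\<lambda>n. blinfun_apply Q (x n)) \<longlonglongrightarrow> g m" if "(\<lambda>n. \<iota> (x n)) \<longlonglongrightarrow> m" for x m
    using continuous_on_tendsto_compose[OF cont that] by (simp add: g_iota)
  have approx: "\<exists>x. (\<lambda>n. \<iota> (x n)) \<longlonglongrightarrow> m" for m
    by (rule dense_range_sequence[OF dense])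
  have g_add: "g (m + m') = g m + g m'" for m m'
  proof -
    obtain x y where xy: "(\<lambda>n. \<iota> (x n)) \<longlonglongrightarrow> m" "(\<lambda>n. \<iota> (y n)) \<longlonglongrightarrow> m'"
      using approx by metis
    have "(\<lambda>n. \<iota> (x n + y n)) \<longlonglongrightarrow> m + m'" unfolding add by (intro tendsto_intros xy)
    from lim[OF this] have "(\<lambda>n. blinfun_apply Q (x n) + blinfun_apply Q (y n)) \<longlonglongrightarrow> g (m + m')"
      by (simp add: blinfun.add_right)
    then show ?thesis using tendsto_add[OF lim[OF xy(1)] lim[OF xy(2)]] LIMSEQ_unique by blast
  qed
  have g_scale: "g (a *\<^sub>C m) = a *\<^sub>C g m" for a m
  proof -
    obtain x where x: "(\<lambda>n. \<iota> (x n)) \<longlonglongrightarrow> m" using approx by metis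
    have "(\<lambda>n. \<iota> (a *\<^sub>C x n)) \<longlonglongrightarrow> a *\<^sub>C m"
      unfolding scale by (rule bounded_linear.tendsto[OF bounded_linear_scaleC x])
    from lim[OF this] have "(\<lambda>n. a *\<^sub>C blinfun_apply Q (x n)) \<longlonglongrightarrow> g (a *\<^sub>C m)"
      by (simp add: clinear_sym_scaleC[OF Q(1)])
    then show ?thesis
      using bounded_linear.tendsto[OF bounded_linear_scaleC lim[OF x]] LIMSEQ_unique by blast
  qed
  have g_norm: "norm (g m) = norm m" for m
  proof -
    obtain x where x: "(\<lambda>n. \<iota> (x n)) \<longlonglongrightarrow> m" using approx by metis
    show ?thesis
      using tendsto_norm[OF x] tendsto_norm[OF lim[OF x]] unfolding iso by (rule LIMSEQ_unique[rotated])
  qed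
  have bl: "bounded_linear g"
    by (rule bounded_linear_intro[of _ 1]) (simp_all add: g_add g_norm g_scale flip: scaleC_of_real)
  note app = bounded_linear_Blinfun_apply[OF bl]
  have "complete (g ` UNIV)"
    by (rule complete_isometric_image[OF zero_less_one subspace_UNIV bl]) (simp_all add: g_norm complete_UNIV)
  moreover have "range (blinfun_apply Q) \<subseteq> range g" using g_iota by (metis image_subsetI rangeI)
  ultimately have "closure (range (blinfun_apply Q)) \<subseteq> range g"
    by (intro closure_minimal complete_imp_closed)
  then have "surj g" unfolding dense_range_sym[OF Q] by blast
  then show ?thesis using that[of "Blinfun g", unfolded app, OF g_iota g_norm _ g_scale] by blast
qed

text \<open>
  Coordinates: \<open>Q\<close> is \<open>(A + 1)\<^sup>-\<^sup>1\<^sup>/\<^sup>2\<close>, a unitary map of the Hilbert space onto \<open>Hplus A\<close> with the norm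
  \<open>norm_plus A\<close>, and \<open>U\<close> is the unitary map of the completion onto the Hilbert space that extends \<open>Q\<close>.
\<close>

locale scale_coordinates =
  fixes A :: "'h::complex_hilbert unbdd_op" and \<iota> :: "'h \<Rightarrow> 'm::complex_hilbert"
    and Q :: "'h \<Rightarrow>\<^sub>L 'h" and U :: "'m \<Rightarrow>\<^sub>L 'h"
  assumes Q_sym: "clinear_sym Q" and Q_inj: "inj (blinfun_apply Q)"
    and Hplus_eq: "Hplus A = range (blinfun_apply Q)"
    and norm_plus_Q: "norm_plus A (blinfun_apply Q x) = norm x"
    and A_eq: "A = {(blinfun_apply Q (blinfun_apply Q x), x - blinfun_apply Q (blinfun_apply Q x)) | x. True}"
    and Q_contr: "norm (x - blinfun_apply Q (blinfun_apply Q x)) \<le> norm x"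
    and dense_\<iota>: "closure (range \<iota>) = UNIV"
    and U_\<iota>: "blinfun_apply U (\<iota> x) = blinfun_apply Q x"
    and norm_U: "norm (blinfun_apply U m) = norm m"
    and U_surj: "surj (blinfun_apply U)"
    and U_scaleC: "blinfun_apply U (a *\<^sub>C m) = a *\<^sub>C blinfun_apply U m"

lemma exists_scale_coordinates:
  assumes A: "positive_selfadjoint_op A" and completion: "minus_completion A \<iota>"
  obtains Q U where "scale_coordinates A \<iota> Q U"
proof -
  obtain Q where Q: "clinear_sym Q" "inj (blinfun_apply Q)" "Hplus A = range (blinfun_apply Q)"
    "op_sqrt (op_plus_one A) = {(blinfun_apply Q x, x) | x. True}"
    "A = {(blinfun_apply Q (blinfun_apply Q x), x - blinfun_apply Q (blinfun_apply Q x)) | x. True}"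
    "\<And>x. norm (x - blinfun_apply Q (blinfun_apply Q x)) \<le> norm x"
    by (rule Hplus_conv[OF A]) (rule that)
  have plus: "norm_plus A (blinfun_apply Q x) = norm x" for x
  proof -
    have "op_app (op_sqrt (op_plus_one A)) (blinfun_apply Q x) = x"
      unfolding op_app_def Q(4) by (rule the_equality) (use Q(2) in \<open>auto dest: injD\<close>)
    then show ?thesis by (simp add: norm_plus_def)
  qed
  have minus: "norm_minus A x = norm (blinfun_apply Q x)" for x
  proof -
    have "op_app ((op_sqrt (op_plus_one A))\<inverse>) x = blinfun_apply Q x"
      unfolding op_app_def Q(4) by (rule the_equality) auto
    then show ?thesis by (simp add: norm_minus_def)
  qed
  have io: "clinear_on UNIV \<iota>" "\<And>x. norm (\<iota> x) = norm (blinfun_apply Q x)" "closure (range \<iota>) = UNIV"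
    using completion unfolding minus_completion_def minus by auto
  obtain U where U: "\<And>x. blinfun_apply U (\<iota> x) = blinfun_apply Q x"
    "\<And>m. norm (blinfun_apply U m) = norm m" "surj (blinfun_apply U)"
    "\<And>a m. blinfun_apply U (a *\<^sub>C m) = a *\<^sub>C blinfun_apply U m"
    by (rule minus_completion_unitary[OF io Q(1,2)]) (rule that)
  have "scale_coordinates A \<iota> Q U"
    by (rule scale_coordinates.intro[OF Q(1-3) plus Q(5,6) io(3) U])
  then show ?thesis by (rule that)
qed

section \<open>The pairings, the extension of \<open>A\<close> and the form operators in
  coordinates\<close>

context scale_coordinates
begin

lemma U_inj: "blinfun_apply U m = blinfun_apply U m' \<Longrightarrow> m = m'"
  using norm_U[of "m - m'"] by (simp add: blinfun.diff_right)

lemma tendsto_Q_filtercomap: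
  "((\<lambda>x. blinfun_apply Q x) \<longlongrightarrow> blinfun_apply U m) (filtercomap \<iota> (nhds m))"
proof -
  have "((\<lambda>x. blinfun_apply U (\<iota> x)) \<longlongrightarrow> blinfun_apply U m) (filtercomap \<iota> (nhds m))"
    by (rule blinfun.tendsto[OF tendsto_const filterlim_filtercomap])
  then show ?thesis unfolding U_\<iota> .
qed

text \<open>\<open>Lim\<close> is evaluated from a known limit only along a nontrivial filter; here
  that is the density of the range of \<open>\<iota>\<close>.\<close>

lemma filtercomap_\<iota>_nontrivial: "filtercomap \<iota> (nhds m) \<noteq> bot"
proof (rule filtercomap_neq_bot)
  fix P assume "eventually P (nhds m)"
  then obtain S where S: "open S" "m \<in> S" "\<And>x. x \<in> S \<Longrightarrow> P x" by (auto simp: eventually_nhds)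
  have "m \<in> closure (range \<iota>)" by (simp add: dense_\<iota>)
  then have "S \<inter> range \<iota> \<noteq> {}" using S(1,2) by (auto simp: closure_iff_nhds_not_empty)
  then show "\<exists>x. P (\<iota> x)" using S(3) by blast
qed

text \<open>Moving \<open>Q\<close> across gives \<open>cinner (Q y) x\<close>, where
  \<open>Q y = U (\<iota> y)\<close> tends to \<open>U m\<close> as \<open>\<iota> y\<close> tends
  to \<open>m\<close>, even if \<open>y\<close> itself diverges.\<close>

lemma pair_mp_eq: "pair_mp \<iota> m (blinfun_apply Q x) = cinner (blinfun_apply U m) x"
  unfolding pair_mp_def
proof (rule tendsto_Lim[OF filtercomap_\<iota>_nontrivial])
  show "((\<lambda>y. cinner y (blinfun_apply Q x)) \<longlongrightarrow> cinner (blinfun_apply U m) x) (filtercomap \<iota> (nhds m))"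
    unfolding clinear_sym_cinner[OF Q_sym, symmetric]
    by (intro tendsto_intros tendsto_Q_filtercomap)
qed

lemma pair_pm_eq: "pair_pm \<iota> (blinfun_apply Q x) m = cinner x (blinfun_apply U m)"
  unfolding pair_pm_def
proof (rule tendsto_Lim[OF filtercomap_\<iota>_nontrivial])
  show "((\<lambda>y. cinner (blinfun_apply Q x) y) \<longlongrightarrow> cinner x (blinfun_apply U m)) (filtercomap \<iota> (nhds m))"
    unfolding clinear_sym_cinner[OF Q_sym]
    by (intro tendsto_intros tendsto_Q_filtercomap)
qed

lemma Q_dense: "closure (range (blinfun_apply Q)) = UNIV"
  by (rule dense_range_sym[OF Q_sym Q_inj])

lemma op_app_A:
  "op_app A (blinfun_apply Q (blinfun_apply Q x)) = x - blinfun_apply Q (blinfun_apply Q x)"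
  unfolding op_app_def
proof (rule the_equality)
  show "(blinfun_apply Q (blinfun_apply Q x), x - blinfun_apply Q (blinfun_apply Q x)) \<in> A"
    by (subst A_eq) blast
  fix y assume "(blinfun_apply Q (blinfun_apply Q x), y) \<in> A"
  then obtain u where "blinfun_apply Q (blinfun_apply Q x) = blinfun_apply Q (blinfun_apply Q u)"
      "y = u - blinfun_apply Q (blinfun_apply Q u)"
    by (subst (asm) A_eq) blast
  then show "y = x - blinfun_apply Q (blinfun_apply Q x)" using Q_inj by (metis injD)
qed

text \<open>Formally \<open>A = Q^(-2) - 1\<close>, so in coordinates it is
  \<open>Q (Q^(-2) - 1) Q = 1 - Q Q\<close>. A point \<open>Q (Q u)\<close> of the domain has plus
  distance \<open>norm (Q u - x)\<close> from \<open>Q x\<close>, and \<open>Q_contr\<close> bounds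
  the distance of the images by the same number.\<close>

lemma U_op_ext: "blinfun_apply U (op_ext \<iota> A (blinfun_apply Q x)) = x - blinfun_apply Q (blinfun_apply Q x)"
proof -
  obtain m where m: "blinfun_apply U m = x - blinfun_apply Q (blinfun_apply Q x)"
    using U_surj by (metis surjD)
  define F where "F = inf (filtercomap (\<lambda>y. norm_plus A (y - blinfun_apply Q x)) (nhds 0)) (principal (Domain A))"
  have plus: "norm_plus A (blinfun_apply Q (blinfun_apply Q u) - blinfun_apply Q x)
      = norm (blinfun_apply Q u - x)" for u
    using norm_plus_Q[of "blinfun_apply Q u - x"] by (simp add: blinfun.diff_right)
  have dom: "y \<in> Domain A \<longleftrightarrow> (\<exists>u. y = blinfun_apply Q (blinfun_apply Q u))" for y
    by (subst A_eq) auto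
  have "op_ext \<iota> A (blinfun_apply Q x) = m"
    unfolding op_ext_def F_def[symmetric]
  proof (rule tendsto_Lim)
    \<comment> \<open>Points of the domain arbitrarily close to \<open>Q x\<close> in plus norm
      exist because vectors \<open>Q u\<close> approximate \<open>x\<close>.\<close>
    have "F \<noteq> bot"
    proof
      assume "F = bot"
      then have "eventually (\<lambda>y. y \<notin> Domain A) (filtercomap (\<lambda>y. norm_plus A (y - blinfun_apply Q x)) (nhds 0))"
        unfolding F_def trivial_limit_def eventually_inf_principal by simp
      then obtain P where P: "eventually P (nhds (0::real))"
          "\<And>y. P (norm_plus A (y - blinfun_apply Q x)) \<Longrightarrow> y \<notin> Domain A"
        by (auto simp: eventually_filtercomap)
      obtain d where d: "d > 0" "\<And>r. dist r 0 < d \<Longrightarrow> P r"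
        using P(1) by (auto simp: eventually_nhds_metric)
      have "x \<in> closure (range (blinfun_apply Q))" by (simp add: Q_dense)
      then obtain u where "dist (blinfun_apply Q u) x < d"
        using d(1) by (auto simp: closure_approachable)
      then have "P (norm_plus A (blinfun_apply Q (blinfun_apply Q u) - blinfun_apply Q x))"
        unfolding plus by (intro d(2)) (simp add: dist_norm)
      then show False using P(2) dom by blast
    qed
    then show "\<not> trivial_limit F" by simp
    show "((\<lambda>y. \<iota> (op_app A y)) \<longlongrightarrow> m) F"
    proof (rule tendstoI)
      fix e :: real assume e: "e > 0"
      have "eventually (\<lambda>r. dist r 0 < e) (nhds (0::real))"
        using e by (auto simp: eventually_nhds_metric)
      then have "eventually (\<lambda>y. dist (norm_plus A (y - blinfun_apply Q x)) 0 < e)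
          (filtercomap (\<lambda>y. norm_plus A (y - blinfun_apply Q x)) (nhds 0))"
        by (rule eventually_filtercomapI)
      moreover have "dist (\<iota> (op_app A y)) m < e"
        if y: "y \<in> Domain A" and small: "dist (norm_plus A (y - blinfun_apply Q x)) 0 < e" for y
      proof -
        obtain u where u: "y = blinfun_apply Q (blinfun_apply Q u)" using y dom by blast
        define v where "v = blinfun_apply Q u - x"
        have "blinfun_apply U (\<iota> (op_app A y) - m) = v - blinfun_apply Q (blinfun_apply Q v)"
          unfolding u op_app_A blinfun.diff_right U_\<iota> m v_def by simp
        then have "norm (\<iota> (op_app A y) - m) \<le> norm v"
          using Q_contr[of v] norm_U by metis
        also have "norm v < e" using small unfolding u plus v_def by simp
        finally show ?thesis by (simp add: dist_norm)
      qed
      ultimately show "eventually (\<lambda>y. dist (\<iota> (op_app A y)) m < e) F"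
        unfolding F_def eventually_inf_principal by (metis (mono_tags, lifting) eventually_mono)
    qed
  qed
  then show ?thesis using m by simp
qed

text \<open>The term \<open>Q (Q x)\<close> contributed by \<open>\<iota> (Q x)\<close> cancels the
  one in \<open>U_op_ext\<close>: in coordinates \<open>A + 1\<close> is the identity, which turns
  (S1) into bounds by multiples of \<open>(norm x)\<^sup>2\<close>.\<close>

lemma form_A_plus_one:
  "Re (pair_pm \<iota> (blinfun_apply Q x)
      (c *\<^sub>R (op_ext \<iota> A (blinfun_apply Q x) + \<iota> (blinfun_apply Q x)))) = c * (norm x)\<^sup>2"
  by (simp add: pair_pm_eq Re_cinner blinfun.scaleR_right blinfun.add_right U_op_ext U_\<iota>
      power2_norm_eq_inner)

lemma form_operator:
  assumes bounded: "bounded_plus_minus A K"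
    and symmetric: "\<And>\<Psi> \<Phi>. \<Psi> \<in> Hplus A \<Longrightarrow> \<Phi> \<in> Hplus A \<Longrightarrow> pair_pm \<iota> \<Psi> (K \<Phi>) = pair_mp \<iota> (K \<Psi>) \<Phi>"
  obtains L where "clinear_sym L" "\<And>x. blinfun_apply U (K (blinfun_apply Q x)) = blinfun_apply L x"
proof -
  obtain M where M: "\<And>\<Phi>. \<Phi> \<in> Hplus A \<Longrightarrow> norm (K \<Phi>) \<le> M * norm_plus A \<Phi>"
    using bounded unfolding bounded_plus_minus_def by blast
  have K_add: "K (blinfun_apply Q (x + y)) = K (blinfun_apply Q x) + K (blinfun_apply Q y)" for x y
    using bounded unfolding bounded_plus_minus_def clinear_on_def Hplus_eq by (simp add: blinfun.add_right)
  have K_scale: "K (blinfun_apply Q (a *\<^sub>C x)) = a *\<^sub>C K (blinfun_apply Q x)" for a x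
    using bounded unfolding bounded_plus_minus_def clinear_on_def Hplus_eq
    by (simp add: clinear_sym_scaleC[OF Q_sym])
  define l where "l x = blinfun_apply U (K (blinfun_apply Q x))" for x
  have l_scale: "l (a *\<^sub>C x) = a *\<^sub>C l x" for a x unfolding l_def K_scale U_scaleC ..
  have bl: "bounded_linear l"
  proof (rule bounded_linear_intro[of _ M])
    show "l (x + y) = l x + l y" for x y unfolding l_def K_add by (rule blinfun.add_right)
    show "l (r *\<^sub>R x) = r *\<^sub>R l x" for r x using l_scale[of "complex_of_real r"] by (simp add: scaleC_of_real)
    show "norm (l x) \<le> norm x * M" for x
      using M[of "blinfun_apply Q x"] unfolding l_def norm_U norm_plus_Q Hplus_eq by (simp add: mult.commute)
  qed
  note app = bounded_linear_Blinfun_apply[OF bl]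
  have "clinear_sym (Blinfun l)"
  proof (rule clinear_symI; unfold app)
    show "l (\<i> *\<^sub>C x) = \<i> *\<^sub>C l x" for x by (rule l_scale)
    fix x y
    have "cinner x (l y) = cinner (l x) y"
      using symmetric[of "blinfun_apply Q x" "blinfun_apply Q y"]
      unfolding pair_pm_eq pair_mp_eq l_def Hplus_eq by simp
    then show "inner (l x) y = inner x (l y)" by (metis Re_cinner)
  qed
  then show ?thesis using that[of "Blinfun l"] unfolding app l_def by blast
qed

end


section \<open>Differentiability of the inverse\<close>

text \<open>The difference quotient at \<open>t\<close> is at most
  \<open>M * \<bar>s - t\<bar>\<close>. This disposes of the product of two Lipschitz increments in
  \<open>K_weakly_C1\<close>.\<close>

lemma has_vector_derivative_quadratic:
  fixes r :: "real \<Rightarrow> real"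
  assumes "t \<in> S" "\<And>s. s \<in> S \<Longrightarrow> \<bar>r s\<bar> \<le> M * (s - t)\<^sup>2"
  shows "(r has_vector_derivative 0) (at t within S)"
proof -
  have "r t = 0" using assms(2)[OF assms(1)] by simp
  have "((\<lambda>s. (r s - r t) / (s - t)) \<longlongrightarrow> 0) (at t within S)"
  proof (rule Lim_null_comparison)
    show "eventually (\<lambda>s. norm ((r s - r t) / (s - t)) \<le> M * \<bar>s - t\<bar>) (at t within S)"
      unfolding eventually_at_filter
    proof (intro always_eventually allI impI)
      fix s assume "s \<noteq> t" "s \<in> S"
      then show "norm ((r s - r t) / (s - t)) \<le> M * \<bar>s - t\<bar>"
        using assms(2)[OF \<open>s \<in> S\<close>] \<open>r t = 0\<close>
        by (simp add: abs_divide divide_le_eq power2_eq_square abs_mult[symmetric] mult.assoc)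
    qed
    have "((\<lambda>s. M * \<bar>s - t\<bar>) \<longlongrightarrow> M * \<bar>t - t\<bar>) (at t within S)" by (intro tendsto_intros)
    then show "((\<lambda>s. M * \<bar>s - t\<bar>) \<longlongrightarrow> 0) (at t within S)" by simp
  qed
  then have "(r has_field_derivative 0) (at t within S)"
    by (simp add: has_field_derivative_iff)
  then show ?thesis by (simp add: has_real_derivative_iff_has_vector_derivative)
qed

text \<open>
  By the bound on \<open>B\<close>, the form of \<open>B t\<close> extends continuously in \<open>Q a\<close> and \<open>Q b\<close>. Hence \<open>Z\<close> is Lipschitz
  in norm and weakly \<open>C\<^sup>1\<close>, and both properties pass to \<open>K\<close> by \<open>K s - K t = - K s (Z s - Z t) K t\<close>.
\<close>

locale inverse_family =
  fixes Q :: "'a::{real_inner,banach} \<Rightarrow>\<^sub>L 'a" and K Z B :: "real \<Rightarrow> 'a \<Rightarrow>\<^sub>L 'a" and T C D :: real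
  assumes T_pos: "0 < T" and C_nonneg: "0 \<le> C" and D_nonneg: "0 \<le> D"
    and Q_sym: "inner (blinfun_apply Q x) y = inner x (blinfun_apply Q y)"
    and Q_dense: "closure (range (blinfun_apply Q)) = UNIV"
    and K_sym: "t \<in> {0..T} \<Longrightarrow> inner (blinfun_apply (K t) x) y = inner x (blinfun_apply (K t) y)"
    and KZ: "t \<in> {0..T} \<Longrightarrow> blinfun_apply (K t) (blinfun_apply (Z t) x) = x"
    and ZK: "t \<in> {0..T} \<Longrightarrow> blinfun_apply (Z t) (blinfun_apply (K t) x) = x"
    and norm_K: "t \<in> {0..T} \<Longrightarrow> norm (K t) \<le> C"
    and deriv: "t \<in> {0..T} \<Longrightarrow> ((\<lambda>s. Q o\<^sub>L Z s o\<^sub>L Q) has_vector_derivative B t) (at t within {0..T})"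
    and bound: "t \<in> {0..T} \<Longrightarrow> \<bar>inner a (blinfun_apply (B t) b)\<bar>
      \<le> D * norm (blinfun_apply Q a) * norm (blinfun_apply Q b)"
    and B_continuous: "continuous_on {0..T} B"
begin

lemma approx: "\<exists>a. (\<lambda>n. blinfun_apply Q (a n)) \<longlonglongrightarrow> x"
  by (rule dense_range_sequence[OF Q_dense])

lemma form_deriv:
  assumes "t \<in> {0..T}"
  shows "((\<lambda>s. inner (blinfun_apply Q a) (blinfun_apply (Z s) (blinfun_apply Q b)))
    has_vector_derivative inner a (blinfun_apply (B t) b)) (at t within {0..T})"
proof -
  have "bounded_linear (\<lambda>W :: 'a \<Rightarrow>\<^sub>L 'a. inner a (blinfun_apply W b))"
    by (rule bounded_linear_compose[OF bounded_linear_inner_right blinfun.bounded_linear_left])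
  from bounded_linear.has_vector_derivative[OF this deriv[OF assms]]
  show ?thesis by (simp add: Q_sym)
qed

text \<open>Mean value inequality. As \<open>bound\<close> involves \<open>norm (Q a)\<close> and
  \<open>norm (Q b)\<close> rather than \<open>norm a\<close> and \<open>norm b\<close>, the
  estimate survives the passage to limits of \<open>Q a\<close> and \<open>Q b\<close> in
  \<open>Z_lipschitz\<close>.\<close>

lemma form_lipschitz:
  assumes "s \<in> {0..T}" "t \<in> {0..T}"
  shows "\<bar>inner (blinfun_apply Q a) (blinfun_apply (Z s - Z t) (blinfun_apply Q b))\<bar>
    \<le> D * norm (blinfun_apply Q a) * norm (blinfun_apply Q b) * \<bar>s - t\<bar>"
proof -
  define c where "c = D * norm (blinfun_apply Q a) * norm (blinfun_apply Q b)"
  have "norm (inner (blinfun_apply Q a) (blinfun_apply (Z s) (blinfun_apply Q b))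
      - inner (blinfun_apply Q a) (blinfun_apply (Z t) (blinfun_apply Q b))) \<le> c * norm (s - t)"
  proof (rule differentiable_bound[OF _ form_deriv[unfolded has_vector_derivative_def] _ assms])
    fix u assume "u \<in> {0..T}"
    then have "\<bar>inner a (blinfun_apply (B u) b)\<bar> \<le> c" unfolding c_def by (rule bound)
    then show "onorm (\<lambda>h. h *\<^sub>R inner a (blinfun_apply (B u) b)) \<le> c"
      by (intro onorm_le) (simp add: abs_mult mult.commute[of c] mult_left_mono)
  qed auto
  then show ?thesis by (simp add: c_def blinfun.diff_left inner_diff_right)
qed

lemma Z_lipschitz:
  assumes "s \<in> {0..T}" "t \<in> {0..T}"
  shows "norm (Z s - Z t) \<le> D * \<bar>s - t\<bar>"
proof -
  have gen: "\<bar>inner x (blinfun_apply (Z s - Z t) y)\<bar> \<le> D * norm x * norm y * \<bar>s - t\<bar>" for x y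
  proof -
    obtain a b where ab: "(\<lambda>n. blinfun_apply Q (a n)) \<longlonglongrightarrow> x" "(\<lambda>n. blinfun_apply Q (b n)) \<longlonglongrightarrow> y"
      using approx by meson
    show ?thesis
    proof (rule LIMSEQ_le)
      show "(\<lambda>n. \<bar>inner (blinfun_apply Q (a n)) (blinfun_apply (Z s - Z t) (blinfun_apply Q (b n)))\<bar>)
          \<longlonglongrightarrow> \<bar>inner x (blinfun_apply (Z s - Z t) y)\<bar>"
        by (intro tendsto_intros ab)
      show "(\<lambda>n. D * norm (blinfun_apply Q (a n)) * norm (blinfun_apply Q (b n)) * \<bar>s - t\<bar>)
          \<longlonglongrightarrow> D * norm x * norm y * \<bar>s - t\<bar>"
        by (intro tendsto_intros ab)
    qed (use form_lipschitz[OF assms] in blast)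
  qed
  show ?thesis
  proof (rule norm_blinfun_bound)
    show "0 \<le> D * \<bar>s - t\<bar>" using D_nonneg by simp
    fix y
    \<comment> \<open>Testing the form bound with \<open>w\<close> itself in the first argument
      turns it into a norm bound.\<close>
    define w where "w = blinfun_apply (Z s - Z t) y"
    have "norm w * norm w \<le> norm w * (D * \<bar>s - t\<bar> * norm y)"
      using gen[of w y] unfolding w_def[symmetric]
      by (simp add: power2_norm_eq_inner[symmetric] power2_eq_square algebra_simps)
    then have "norm w \<le> D * \<bar>s - t\<bar> * norm y"
      using D_nonneg by (cases "w = 0") auto
    then show "norm (blinfun_apply (Z s - Z t) y) \<le> D * \<bar>s - t\<bar> * norm y" unfolding w_def .
  qed
qed

text \<open>Change one argument at a time. The right side is independent of \<open>t\<close> and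
  contains the vectors only through \<open>Q\<close>; this matters because \<open>a n\<close> need
  not converge when \<open>Q (a n)\<close> does.\<close>

lemma form_diff_bound:
  assumes "t \<in> {0..T}"
  shows "\<bar>inner a (blinfun_apply (B t) b) - inner a' (blinfun_apply (B t) b')\<bar>
    \<le> D * (norm (blinfun_apply Q a - blinfun_apply Q a') * norm (blinfun_apply Q b)
      + norm (blinfun_apply Q a') * norm (blinfun_apply Q b - blinfun_apply Q b'))"
proof -
  have "inner a (blinfun_apply (B t) b) - inner a' (blinfun_apply (B t) b')
      = inner (a - a') (blinfun_apply (B t) b) + inner a' (blinfun_apply (B t) (b - b'))"
    by (simp add: inner_diff_left inner_diff_right blinfun.diff_right)
  also have "\<bar>\<dots>\<bar> \<le> \<bar>inner (a - a') (blinfun_apply (B t) b)\<bar> + \<bar>inner a' (blinfun_apply (B t) (b - b'))\<bar>"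
    by (rule abs_triangle_ineq)
  finally show ?thesis
    using bound[OF assms, of "a - a'" b] bound[OF assms, of a' "b - b'"]
    by (simp add: blinfun.diff_right algebra_simps)
qed

text \<open>Along \<open>Q (a n)\<close> and \<open>Q (b n)\<close> converging to \<open>x\<close>
  and \<open>y\<close>, the derivatives \<open>d n\<close> of the matrix elements converge uniformly
  in \<open>t\<close>. Their limit \<open>e\<close> is therefore continuous and is the derivative of
  the limit of the matrix elements.\<close>

lemma weak_derivative:
  "\<exists>e. continuous_on {0..T} e \<and> (\<forall>t\<in>{0..T}. \<bar>e t\<bar> \<le> D * norm x * norm y \<and>
     ((\<lambda>s. inner x (blinfun_apply (Z s) y)) has_vector_derivative e t) (at t within {0..T}))"
proof -
  obtain a b where a: "(\<lambda>n. blinfun_apply Q (a n)) \<longlonglongrightarrow> x" and b: "(\<lambda>n. blinfun_apply Q (b n)) \<longlonglongrightarrow> y"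
    using approx by meson
  define d where "d n t = inner (a n) (blinfun_apply (B t) (b n))" for n t
  have d_diff: "\<bar>d m t - d n t\<bar>
    \<le> D * (norm (blinfun_apply Q (a m) - blinfun_apply Q (a n)) * norm (blinfun_apply Q (b m))
      + norm (blinfun_apply Q (a n)) * norm (blinfun_apply Q (b m) - blinfun_apply Q (b n)))"
    if "t \<in> {0..T}" for t m n
    unfolding d_def by (rule form_diff_bound[OF that])
  obtain X where X: "\<And>n. norm (blinfun_apply Q (a n)) \<le> X" "X > 0"
    using convergent_imp_Bseq[OF convergentI[OF a]] by (auto simp: Bseq_def)
  obtain Y where Y: "\<And>n. norm (blinfun_apply Q (b n)) \<le> Y" "Y > 0"
    using convergent_imp_Bseq[OF convergentI[OF b]] by (auto simp: Bseq_def)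
  have "\<exists>l. (\<lambda>n. d n t) \<longlonglongrightarrow> l" if t: "t \<in> {0..T}" for t
  proof -
    have "Cauchy (\<lambda>n. d n t)"
    proof (rule metric_CauchyI)
      fix r :: real assume r: "r > 0"
      \<comment> \<open>The summand 1 keeps \<open>G\<close> positive and makes the final estimate
        \<open>(G - 1) * (r / G) < r\<close> strict.\<close>
      define G where "G = D * (X + Y) + 1"
      have G: "G > 0" using D_nonneg X(2) Y(2) unfolding G_def by (simp add: add_nonneg_pos)
      have rG: "r / G > 0" using r G by simp
      obtain N1 where N1: "\<And>m n. m \<ge> N1 \<Longrightarrow> n \<ge> N1 \<Longrightarrow>
          norm (blinfun_apply Q (a m) - blinfun_apply Q (a n)) < r / G"
        using CauchyD[OF LIMSEQ_imp_Cauchy[OF a] rG] by blast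
      obtain N2 where N2: "\<And>m n. m \<ge> N2 \<Longrightarrow> n \<ge> N2 \<Longrightarrow>
          norm (blinfun_apply Q (b m) - blinfun_apply Q (b n)) < r / G"
        using CauchyD[OF LIMSEQ_imp_Cauchy[OF b] rG] by blast
      have "dist (d m t) (d n t) < r" if "m \<ge> max N1 N2" "n \<ge> max N1 N2" for m n
      proof -
        have "norm (blinfun_apply Q (a m) - blinfun_apply Q (a n)) * norm (blinfun_apply Q (b m)) \<le> r / G * Y"
          by (intro mult_mono Y less_imp_le[OF N1]) (use that rG in auto)
        moreover have "norm (blinfun_apply Q (a n)) * norm (blinfun_apply Q (b m) - blinfun_apply Q (b n)) \<le> X * (r / G)"
          by (intro mult_mono X less_imp_le[OF N2]) (use that X(2) in auto)
        ultimately have "\<bar>d m t - d n t\<bar> \<le> D * (r / G * Y + X * (r / G))"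
          using d_diff[OF t, of m n] D_nonneg by (meson add_mono mult_left_mono order_trans)
        also have "\<dots> = (G - 1) * (r / G)" unfolding G_def by (simp add: algebra_simps add_divide_distrib)
        also have "\<dots> < r" using G r by (simp add: field_simps)
        finally show ?thesis by (simp add: dist_real_def)
      qed
      then show "\<exists>N. \<forall>m\<ge>N. \<forall>n\<ge>N. dist (d m t) (d n t) < r" by blast
    qed
    then show ?thesis using Cauchy_convergent_iff convergent_def by blast
  qed
  then have "\<forall>t. \<exists>l. t \<in> {0..T} \<longrightarrow> (\<lambda>n. d n t) \<longlonglongrightarrow> l" by blast
  from choice[OF this] obtain e where e: "\<And>t. t \<in> {0..T} \<Longrightarrow> (\<lambda>n. d n t) \<longlonglongrightarrow> e t" by blast
  \<comment> \<open>The limit in \<open>m\<close> of the bound \<open>d_diff\<close>; its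
    independence of \<open>t\<close> is what yields uniform convergence.\<close>
  define \<delta> where "\<delta> n = D * (norm (x - blinfun_apply Q (a n)) * norm y
      + norm (blinfun_apply Q (a n)) * norm (y - blinfun_apply Q (b n)))" for n
  have d_e: "\<bar>e t - d n t\<bar> \<le> \<delta> n" if t: "t \<in> {0..T}" for t n
  proof (rule LIMSEQ_le)
    show "(\<lambda>m. \<bar>d m t - d n t\<bar>) \<longlonglongrightarrow> \<bar>e t - d n t\<bar>"
      by (intro tendsto_intros e[OF t])
    show "(\<lambda>m. D * (norm (blinfun_apply Q (a m) - blinfun_apply Q (a n)) * norm (blinfun_apply Q (b m))
      + norm (blinfun_apply Q (a n)) * norm (blinfun_apply Q (b m) - blinfun_apply Q (b n)))) \<longlonglongrightarrow> \<delta> n"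
      unfolding \<delta>_def by (intro tendsto_intros a b)
  qed (use d_diff[OF t] in blast)
  have "\<delta> \<longlonglongrightarrow> D * (norm (x - x) * norm y + norm x * norm (y - y))"
    unfolding \<delta>_def by (intro tendsto_intros a b)
  then have \<delta>: "\<delta> \<longlonglongrightarrow> 0" by simp
  have ev: "eventually (\<lambda>n. \<delta> n < r) sequentially" if "r > 0" for r
    using order_tendstoD(2)[OF \<delta> that] .
  have "uniform_limit {0..T} d e sequentially"
  proof (rule uniform_limitI)
    fix r :: real assume "r > 0"
    show "eventually (\<lambda>n. \<forall>t\<in>{0..T}. dist (d n t) (e t) < r) sequentially"
      using ev[OF \<open>r > 0\<close>]
    proof (rule eventually_mono)
      fix n assume n: "\<delta> n < r"
      show "\<forall>t\<in>{0..T}. dist (d n t) (e t) < r"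
        using d_e n by (metis abs_minus_commute dist_real_def order_le_less_trans)
    qed
  qed
  then have "continuous_on {0..T} e"
  proof (rule uniform_limit_theorem[rotated])
    have "continuous_on {0..T} (d n)" for n
      unfolding d_def by (intro continuous_intros B_continuous)
    then show "eventually (\<lambda>n. continuous_on {0..T} (d n)) sequentially" by simp
  qed simp
  moreover have "\<bar>e t\<bar> \<le> D * norm x * norm y" if t: "t \<in> {0..T}" for t
  proof (rule LIMSEQ_le)
    show "(\<lambda>n. \<bar>d n t\<bar>) \<longlonglongrightarrow> \<bar>e t\<bar>" by (intro tendsto_intros e[OF t])
    show "(\<lambda>n. D * norm (blinfun_apply Q (a n)) * norm (blinfun_apply Q (b n))) \<longlonglongrightarrow> D * norm x * norm y"
      by (intro tendsto_intros a b)
  qed (use bound[OF t] in \<open>auto simp: d_def\<close>)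
  moreover have "((\<lambda>s. inner x (blinfun_apply (Z s) y)) has_vector_derivative e t) (at t within {0..T})"
    if t: "t \<in> {0..T}" for t
  proof -
    define f where "f n s = inner (blinfun_apply Q (a n)) (blinfun_apply (Z s) (blinfun_apply Q (b n)))" for n s
    have f_lim: "(\<lambda>n. f n s) \<longlonglongrightarrow> inner x (blinfun_apply (Z s) y)" for s
      unfolding f_def by (intro tendsto_intros a b)
    \<comment> \<open>Differentiation of a sequence of functions yields some limit function
      \<open>g\<close>; \<open>f_lim\<close> then identifies it with the matrix element of
      \<open>Z\<close>.\<close>
    have "\<exists>g. \<forall>s\<in>{0..T}. (\<lambda>n. f n s) \<longlonglongrightarrow> g s \<and> (g has_derivative (\<lambda>h. h *\<^sub>R e s)) (at s within {0..T})"
    proof (rule has_derivative_sequence[OF _ _ _ t f_lim])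
      show "(f n has_derivative (\<lambda>h. h *\<^sub>R d n s)) (at s within {0..T})" if "s \<in> {0..T}" for n s
        using form_deriv[OF that] unfolding f_def d_def has_vector_derivative_def .
      fix r :: real assume "r > 0"
      show "eventually (\<lambda>n. \<forall>s\<in>{0..T}. \<forall>h. norm (h *\<^sub>R d n s - h *\<^sub>R e s) \<le> r * norm h) sequentially"
        using ev[OF \<open>r > 0\<close>]
      proof (rule eventually_mono)
        fix n assume n: "\<delta> n < r"
        show "\<forall>s\<in>{0..T}. \<forall>h. norm (h *\<^sub>R d n s - h *\<^sub>R e s) \<le> r * norm h"
        proof (intro ballI allI)
          fix s h assume "s \<in> {0..T}"
          then have "\<bar>d n s - e s\<bar> \<le> r" using d_e[of s n] n by (simp add: abs_minus_commute)
          then have "\<bar>h\<bar> * \<bar>d n s - e s\<bar> \<le> \<bar>h\<bar> * r" by (rule mult_left_mono) simp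
          then show "norm (h *\<^sub>R d n s - h *\<^sub>R e s) \<le> r * norm h"
            by (simp add: abs_mult mult.commute flip: right_diff_distrib)
        qed
      qed
    qed simp
    then obtain g where g: "\<And>s. s \<in> {0..T} \<Longrightarrow> (\<lambda>n. f n s) \<longlonglongrightarrow> g s"
        "\<And>s. s \<in> {0..T} \<Longrightarrow> (g has_derivative (\<lambda>h. h *\<^sub>R e s)) (at s within {0..T})" by blast
    have "g s = inner x (blinfun_apply (Z s) y)" if "s \<in> {0..T}" for s
      using LIMSEQ_unique[OF g(1)[OF that] f_lim] .
    then show ?thesis
      unfolding has_vector_derivative_def using has_derivative_transform[OF t _ g(2)[OF t]] by simp
  qed
  ultimately show ?thesis by blast
qed

section \<open>From \<open>Z\<close> back to \<open>K\<close>\<close>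

lemma K_diff:
  assumes "s \<in> {0..T}" "t \<in> {0..T}"
  shows "blinfun_apply (K s) y - blinfun_apply (K t) y
    = - blinfun_apply (K s) (blinfun_apply (Z s - Z t) (blinfun_apply (K t) y))"
  by (simp add: blinfun.diff_left blinfun.diff_right KZ[OF assms(1)] ZK[OF assms(2)])

lemma norm_K_apply:
  assumes "t \<in> {0..T}"
  shows "norm (blinfun_apply (K t) x) \<le> C * norm x"
  by (rule order_trans[OF norm_blinfun mult_right_mono[OF norm_K[OF assms]]]) simp

lemma K_lipschitz:
  assumes "s \<in> {0..T}" "t \<in> {0..T}"
  shows "norm (blinfun_apply (K s) y - blinfun_apply (K t) y) \<le> C * D * C * norm y * \<bar>s - t\<bar>"
proof -
  have "norm (blinfun_apply (K s) (blinfun_apply (Z s - Z t) (blinfun_apply (K t) y)))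
      \<le> C * norm (blinfun_apply (Z s - Z t) (blinfun_apply (K t) y))"
    by (rule norm_K_apply[OF assms(1)])
  also have "\<dots> \<le> C * (D * \<bar>s - t\<bar> * (C * norm y))"
  proof (rule mult_left_mono[OF _ C_nonneg])
    show "norm (blinfun_apply (Z s - Z t) (blinfun_apply (K t) y)) \<le> D * \<bar>s - t\<bar> * (C * norm y)"
      by (rule order_trans[OF norm_blinfun mult_mono[OF Z_lipschitz[OF assms] norm_K_apply[OF assms(2)]]])
        (use D_nonneg in auto)
  qed
  finally show ?thesis unfolding K_diff[OF assms] by (simp add: algebra_simps)
qed

text \<open>In the formula for \<open>K s - K t\<close>, moving \<open>K s\<close> to the left
  argument and replacing it by \<open>K t\<close> leaves a product of an increment of
  \<open>K\<close> and one of \<open>Z\<close>. The derivative is thus minus that of the matrix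
  element of \<open>Z\<close> at the vectors \<open>K t x\<close> and \<open>K t y\<close>, frozen
  at \<open>t\<close>.\<close>

lemma K_weakly_C1:
  "\<exists>f'. continuous_on {0..T} f' \<and> (\<forall>t\<in>{0..T}.
     ((\<lambda>s. inner x (blinfun_apply (K s) y)) has_vector_derivative f' t) (at t within {0..T}))"
proof -
  have "\<forall>p. \<exists>e. continuous_on {0..T} e \<and> (\<forall>t\<in>{0..T}. \<bar>e t\<bar> \<le> D * norm (fst p) * norm (snd p) \<and>
     ((\<lambda>s. inner (fst p) (blinfun_apply (Z s) (snd p))) has_vector_derivative e t) (at t within {0..T}))"
    using weak_derivative by blast
  from choice[OF this] obtain e' where e': "\<And>p. continuous_on {0..T} (e' p)"
    "\<And>p t. t \<in> {0..T} \<Longrightarrow> \<bar>e' p t\<bar> \<le> D * norm (fst p) * norm (snd p)"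
    "\<And>p t. t \<in> {0..T} \<Longrightarrow> ((\<lambda>s. inner (fst p) (blinfun_apply (Z s) (snd p)))
      has_vector_derivative e' p t) (at t within {0..T})" by blast
  define e where "e u v = e' (u, v)" for u v
  have e_cont: "continuous_on {0..T} (e u v)"
    and e_bound: "t \<in> {0..T} \<Longrightarrow> \<bar>e u v t\<bar> \<le> D * norm u * norm v"
    and e_deriv: "t \<in> {0..T} \<Longrightarrow> ((\<lambda>s. inner u (blinfun_apply (Z s) v))
      has_vector_derivative e u v t) (at t within {0..T})" for u v t
    using e'(1)[where p = "(u, v)"] e'(2,3)[where p = "(u, v)"] unfolding e_def by auto
  \<comment> \<open>\<open>e'\<close> was chosen separately for each pair of vectors. Its additivity
    is recovered from uniqueness of the derivative, which at the endpoints of \<open>{0..T}\<close>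
    relies on \<open>T_pos\<close>.\<close>
  have unique: "p = q" if t: "t \<in> {0..T}" and "(g has_vector_derivative p) (at t within {0..T})"
    "(g has_vector_derivative q) (at t within {0..T})" for g :: "real \<Rightarrow> real" and p q t
    using vector_derivative_unique_within_closed_interval[OF T_pos, of t g p q] that by simp
  have e_diff_left: "e (u - u') v t = e u v t - e u' v t"
    and e_diff_right: "e u (v - v') t = e u v t - e u v' t" if t: "t \<in> {0..T}" for u u' v v' t
    using unique[OF t e_deriv[OF t, of "u - u'" v]] unique[OF t e_deriv[OF t, of u "v - v'"]]
      has_vector_derivative_diff[OF e_deriv[OF t] e_deriv[OF t]]
    by (simp_all add: inner_diff_left inner_diff_right blinfun.diff_right)
  define f' where "f' t = - e (blinfun_apply (K t) x) (blinfun_apply (K t) y) t" for t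
  have "((\<lambda>s. inner x (blinfun_apply (K s) y)) has_vector_derivative f' t) (at t within {0..T})"
    if t: "t \<in> {0..T}" for t
  proof -
    define u v where "u = blinfun_apply (K t) x" and "v = blinfun_apply (K t) y"
    define r where "r s = - inner (blinfun_apply (K s) x - blinfun_apply (K t) x) (blinfun_apply (Z s - Z t) v)" for s
    have split: "inner x (blinfun_apply (K s) y)
        = inner x (blinfun_apply (K t) y) - (inner u (blinfun_apply (Z s) v) - inner u (blinfun_apply (Z t) v)) + r s"
      if s: "s \<in> {0..T}" for s
    proof -
      have "inner x (blinfun_apply (K s) y) - inner x (blinfun_apply (K t) y)
          = - inner (blinfun_apply (K s) x) (blinfun_apply (Z s - Z t) v)"
        unfolding inner_diff_right[symmetric] K_diff[OF s t] K_sym[OF s] v_def by simp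
      also have "\<dots> = - inner u (blinfun_apply (Z s - Z t) v) + r s"
        unfolding r_def u_def by (simp add: inner_diff_left)
      finally show ?thesis by (simp add: blinfun.diff_left inner_diff_right)
    qed
    have "\<bar>r s\<bar> \<le> C * D * C * norm x * (D * norm v) * (s - t)\<^sup>2" if s: "s \<in> {0..T}" for s
    proof -
      have "\<bar>r s\<bar> \<le> norm (blinfun_apply (K s) x - blinfun_apply (K t) x) * norm (blinfun_apply (Z s - Z t) v)"
        unfolding r_def abs_minus_cancel by (rule Cauchy_Schwarz_ineq2)
      also have "\<dots> \<le> (C * D * C * norm x * \<bar>s - t\<bar>) * (D * \<bar>s - t\<bar> * norm v)"
      proof (rule mult_mono[OF K_lipschitz[OF s t]])
        show "norm (blinfun_apply (Z s - Z t) v) \<le> D * \<bar>s - t\<bar> * norm v"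
          by (rule order_trans[OF norm_blinfun mult_right_mono[OF Z_lipschitz[OF s t]]]) simp
      qed (use C_nonneg D_nonneg in auto)
      also have "\<dots> = C * D * C * norm x * (D * norm v) * (\<bar>s - t\<bar> * \<bar>s - t\<bar>)"
        by (simp only: mult_ac)
      also have "\<bar>s - t\<bar> * \<bar>s - t\<bar> = (s - t)\<^sup>2" by (simp add: power2_eq_square)
      finally show ?thesis .
    qed
    from has_vector_derivative_quadratic[OF t this]
    have r: "(r has_vector_derivative 0) (at t within {0..T})" .
    have "((\<lambda>s. inner x (blinfun_apply (K t) y) - (inner u (blinfun_apply (Z s) v) - inner u (blinfun_apply (Z t) v)) + r s)
        has_vector_derivative 0 - (e u v t - 0) + 0) (at t within {0..T})"
      by (intro has_vector_derivative_add has_vector_derivative_diff has_vector_derivative_const e_deriv[OF t] r)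
    then have "((\<lambda>s. inner x (blinfun_apply (K s) y)) has_vector_derivative 0 - (e u v t - 0) + 0) (at t within {0..T})"
      unfolding has_vector_derivative_def using split by (rule has_derivative_transform[OF t, rotated])
    then show ?thesis unfolding f'_def u_def v_def by simp
  qed
  moreover have "continuous_on {0..T} f'"
    unfolding continuous_on_def
  proof
    fix t assume t: "t \<in> {0..T}"
    define u v where "u = blinfun_apply (K t) x" and "v = blinfun_apply (K t) y"
    define M where "M = D * (C * D * C * norm x) * (C * norm y) + D * norm u * (C * D * C * norm y)"
    \<comment> \<open>Both arguments of \<open>e\<close> move with \<open>s\<close>. Their changes
      are absorbed by \<open>e_bound\<close>, uniform in \<open>s\<close>, and the Lipschitz bound
      on \<open>K\<close>; what is left is the continuous function \<open>e u v\<close> at fixed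
      arguments.\<close>
    have est: "\<bar>e (blinfun_apply (K s) x) (blinfun_apply (K s) y) s - e u v t\<bar>
        \<le> M * \<bar>s - t\<bar> + \<bar>e u v s - e u v t\<bar>" if s: "s \<in> {0..T}" for s
    proof -
      have "\<bar>e (blinfun_apply (K s) x - u) (blinfun_apply (K s) y) s\<bar>
          \<le> D * norm (blinfun_apply (K s) x - u) * norm (blinfun_apply (K s) y)"
        by (rule e_bound[OF s])
      also have "\<dots> \<le> D * (C * D * C * norm x * \<bar>s - t\<bar>) * (C * norm y)"
        unfolding u_def
        by (intro mult_mono order_refl K_lipschitz[OF s t] norm_K_apply[OF s])
          (use C_nonneg D_nonneg in auto)
      finally have 1: "\<bar>e (blinfun_apply (K s) x - u) (blinfun_apply (K s) y) s\<bar>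
          \<le> D * (C * D * C * norm x * \<bar>s - t\<bar>) * (C * norm y)" .
      have "\<bar>e u (blinfun_apply (K s) y - v) s\<bar> \<le> D * norm u * norm (blinfun_apply (K s) y - v)"
        by (rule e_bound[OF s])
      also have "\<dots> \<le> D * norm u * (C * D * C * norm y * \<bar>s - t\<bar>)"
        unfolding v_def
        by (intro mult_mono order_refl K_lipschitz[OF s t]) (use C_nonneg D_nonneg in auto)
      finally have 2: "\<bar>e u (blinfun_apply (K s) y - v) s\<bar> \<le> D * norm u * (C * D * C * norm y * \<bar>s - t\<bar>)" .
      have "e (blinfun_apply (K s) x) (blinfun_apply (K s) y) s - e u v t
          = e (blinfun_apply (K s) x - u) (blinfun_apply (K s) y) s + e u (blinfun_apply (K s) y - v) s
            + (e u v s - e u v t)"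
        by (simp add: e_diff_left[OF s] e_diff_right[OF s])
      moreover have "M * \<bar>s - t\<bar> = D * (C * D * C * norm x * \<bar>s - t\<bar>) * (C * norm y)
          + D * norm u * (C * D * C * norm y * \<bar>s - t\<bar>)"
        unfolding M_def by (simp add: algebra_simps)
      ultimately show ?thesis using 1 2 by linarith
    qed
    have "((\<lambda>s. M * \<bar>s - t\<bar> + \<bar>e u v s - e u v t\<bar>) \<longlongrightarrow> M * \<bar>t - t\<bar> + \<bar>e u v t - e u v t\<bar>) (at t within {0..T})"
      using e_cont[of u v] t unfolding continuous_on_def by (intro tendsto_intros) auto
    then have "((\<lambda>s. M * \<bar>s - t\<bar> + \<bar>e u v s - e u v t\<bar>) \<longlongrightarrow> 0) (at t within {0..T})" by simp
    moreover have "eventually (\<lambda>s. norm (e (blinfun_apply (K s) x) (blinfun_apply (K s) y) s - e u v t)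
        \<le> M * \<bar>s - t\<bar> + \<bar>e u v s - e u v t\<bar>) (at t within {0..T})"
      unfolding eventually_at_filter using est by (intro always_eventually) auto
    ultimately have "((\<lambda>s. e (blinfun_apply (K s) x) (blinfun_apply (K s) y) s - e u v t) \<longlongrightarrow> 0) (at t within {0..T})"
      by (rule Lim_null_comparison[rotated])
    then have "((\<lambda>s. e (blinfun_apply (K s) x) (blinfun_apply (K s) y) s) \<longlongrightarrow> e u v t) (at t within {0..T})"
      by (rule LIM_zero_cancel)
    then show "(f' \<longlongrightarrow> f' t) (at t within {0..T})"
      unfolding f'_def u_def v_def by (rule tendsto_minus)
  qed
  ultimately show ?thesis by blast
qed

end


section \<open>The forms in coordinates\<close>

text \<open>Polarization and the parallelogram law bound \<open>2 * inner u (K v)\<close> by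
  \<open>c\<close> times the sum of the squared norms. Taking \<open>u\<close> along
  \<open>K v\<close> with the norm of \<open>v\<close> gives the operator norm.\<close>

lemma norm_symmetric_le:
  fixes K :: "'a::real_inner \<Rightarrow>\<^sub>L 'a"
  assumes sym: "\<And>x y. inner (blinfun_apply K x) y = inner x (blinfun_apply K y)"
    and form: "\<And>x. \<bar>inner x (blinfun_apply K x)\<bar> \<le> c * (norm x)\<^sup>2" and "0 \<le> c"
  shows "norm K \<le> c"
proof (rule norm_blinfun_bound[OF \<open>0 \<le> c\<close>])
  fix x
  have parallelogram: "(norm (u + v))\<^sup>2 + (norm (u - v))\<^sup>2 = 2 * (norm u)\<^sup>2 + 2 * (norm v)\<^sup>2" for u v :: 'a
    by (simp add: power2_norm_eq_inner inner_add_left inner_add_right inner_diff_left inner_diff_right)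
  have polar: "2 * inner u (blinfun_apply K v) \<le> c * ((norm u)\<^sup>2 + (norm v)\<^sup>2)" for u v
  proof -
    have "4 * inner u (blinfun_apply K v)
        = inner (u + v) (blinfun_apply K (u + v)) - inner (u - v) (blinfun_apply K (u - v))"
      using sym[of u v] by (simp add: inner_add_left inner_add_right inner_diff_left inner_diff_right
          blinfun.add_right blinfun.diff_right inner_commute)
    also have "\<dots> \<le> c * (norm (u + v))\<^sup>2 + c * (norm (u - v))\<^sup>2"
      using form[of "u + v"] form[of "u - v"] by linarith
    also have "\<dots> = c * (2 * (norm u)\<^sup>2 + 2 * (norm v)\<^sup>2)"
      by (simp only: parallelogram distrib_left[symmetric])
    finally show ?thesis by (simp add: algebra_simps)
  qed
  define w where "w = blinfun_apply K x"
  show "norm (blinfun_apply K x) \<le> c * norm x"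
  proof (cases "w = 0 \<or> x = 0")
    case True
    then show ?thesis using \<open>0 \<le> c\<close> unfolding w_def by (auto simp: blinfun.zero_right)
  next
    case False
    \<comment> \<open>Scaling \<open>w\<close> to the norm of \<open>x\<close> balances the two
      squares in \<open>polar\<close>.\<close>
    define k where "k = norm x / norm w"
    have k: "k > 0" "norm (k *\<^sub>R w) = norm x" unfolding k_def using False by auto
    have "k * (norm w)\<^sup>2 \<le> c * (norm x)\<^sup>2"
      using polar[of "k *\<^sub>R w" x] k(2) unfolding w_def[symmetric]
      by (simp add: power2_norm_eq_inner)
    also have "k * (norm w)\<^sup>2 = norm x * norm w" unfolding k_def by (simp add: power2_eq_square)
    finally show ?thesis using False unfolding w_def by (simp add: power2_eq_square mult.left_commute)
  qed
qed

text \<open>The imaginary part is minus the real form with \<open>\<i> *\<^sub>C y\<close> in place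
  of \<open>y\<close>, so \<open>weak\<close> applies to both parts.\<close>

lemma C1_on_cinner:
  fixes K :: "real \<Rightarrow> 'a::complex_hilbert \<Rightarrow>\<^sub>L 'a"
  assumes weak: "\<And>x y. \<exists>f'. continuous_on S f' \<and> (\<forall>t\<in>S.
      ((\<lambda>s. inner x (blinfun_apply (K s) y)) has_vector_derivative f' t) (at t within S))"
    and scale: "\<And>t y. t \<in> S \<Longrightarrow> blinfun_apply (K t) (\<i> *\<^sub>C y) = \<i> *\<^sub>C blinfun_apply (K t) y"
  shows "C1_on S (\<lambda>t. cinner x (blinfun_apply (K t) y))"
proof -
  obtain f' where f': "continuous_on S f'" "\<And>t. t \<in> S \<Longrightarrow>
      ((\<lambda>s. inner x (blinfun_apply (K s) y)) has_vector_derivative f' t) (at t within S)"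
    using weak by blast
  obtain g' where g': "continuous_on S g'" "\<And>t. t \<in> S \<Longrightarrow>
      ((\<lambda>s. inner x (blinfun_apply (K s) (\<i> *\<^sub>C y))) has_vector_derivative g' t) (at t within S)"
    using weak by blast
  have "((\<lambda>s. cinner x (blinfun_apply (K s) y)) has_vector_derivative Complex (f' t) (- g' t)) (at t within S)"
    if t: "t \<in> S" for t
  proof -
    have eq: "cinner x (blinfun_apply (K s) y) = complex_of_real (inner x (blinfun_apply (K s) y))
          - \<i> * complex_of_real (inner x (blinfun_apply (K s) (\<i> *\<^sub>C y)))" if "s \<in> S" for s
      by (simp add: cinner_conv complex_eq_iff scale[OF that])
    have "((\<lambda>s. complex_of_real (inner x (blinfun_apply (K s) y))
          - \<i> * complex_of_real (inner x (blinfun_apply (K s) (\<i> *\<^sub>C y))))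
        has_vector_derivative complex_of_real (f' t) - \<i> * complex_of_real (g' t)) (at t within S)"
      by (intro has_vector_derivative_diff has_vector_derivative_mult_right has_vector_derivative_of_real
          has_real_derivative_iff_has_vector_derivative[THEN iffD2] f'(2) g'(2) t)
    from has_vector_derivative_transform[OF t eq this]
    have "((\<lambda>s. cinner x (blinfun_apply (K s) y)) has_vector_derivative
        complex_of_real (f' t) - \<i> * complex_of_real (g' t)) (at t within S)" .
    moreover have "complex_of_real (f' t) - \<i> * complex_of_real (g' t) = Complex (f' t) (- g' t)"
      by (simp add: complex_eq_iff)
    ultimately show ?thesis by simp
  qed
  moreover have "continuous_on S (\<lambda>t. Complex (f' t) (- g' t))"
    by (intro continuous_intros f' g')
  ultimately show ?thesis unfolding C1_on_def by blast
qed

section \<open>The inverse of \<open>H(t)\<close>, the bound on \<open>B(t)\<close> and the Hilbert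
  space structure on \<open>Hplus A\<close>\<close>

context scale_coordinates
begin

text \<open>Applying the injective map \<open>U\<close> to \<open>H (Q x) = \<iota> y\<close> gives
  \<open>L x = Q y\<close>, that is \<open>x = Z (Q y)\<close>.\<close>

lemma restrict_op_coordinates:
  assumes L: "\<And>x. blinfun_apply U (H (blinfun_apply Q x)) = blinfun_apply L x"
    and LZ: "\<And>x. blinfun_apply L (blinfun_apply Z x) = x" and ZL: "\<And>x. blinfun_apply Z (blinfun_apply L x) = x"
  shows "restrict_op \<iota> A H = {(blinfun_apply (Q o\<^sub>L Z o\<^sub>L Q) y, y) | y. True}"
proof -
  have "H (blinfun_apply Q x) = \<iota> y \<longleftrightarrow> x = blinfun_apply Z (blinfun_apply Q y)" for x y
  proof -
    have "H (blinfun_apply Q x) = \<iota> y \<longleftrightarrow> blinfun_apply U (H (blinfun_apply Q x)) = blinfun_apply U (\<iota> y)"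
      by (auto dest: U_inj)
    also have "\<dots> \<longleftrightarrow> blinfun_apply L x = blinfun_apply Q y" unfolding L U_\<iota> ..
    also have "\<dots> \<longleftrightarrow> x = blinfun_apply Z (blinfun_apply Q y)" using LZ ZL by metis
    finally show ?thesis .
  qed
  then show ?thesis unfolding restrict_op_def Hplus_eq by auto
qed

lemma op_inverse_coordinates: "op_inverse {(blinfun_apply Z y, y) | y. True} = Z"
proof -
  have "op_app ({(blinfun_apply Z y, y) | y. True}\<inverse>) = blinfun_apply Z"
    unfolding op_app_def by auto
  then show ?thesis unfolding op_inverse_def by (simp add: blinfun_apply_inverse)
qed

lemma conjugated_inverse:
  assumes Z: "clinear_sym Z" "inj (blinfun_apply Z)" "\<And>x. 0 \<le> inner x (blinfun_apply Z x)"
  shows "clinear_sym (Q o\<^sub>L Z o\<^sub>L Q)" "inj (blinfun_apply (Q o\<^sub>L Z o\<^sub>L Q))"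
    "0 \<le> inner x (blinfun_apply (Q o\<^sub>L Z o\<^sub>L Q) x)"
proof -
  show "clinear_sym (Q o\<^sub>L Z o\<^sub>L Q)"
    by (rule clinear_symI) (simp_all add: clinear_sym_scaleC[OF Q_sym] clinear_sym_scaleC[OF Z(1)]
        clinear_sym_inner[OF Q_sym] clinear_sym_inner[OF Z(1)])
  show "inj (blinfun_apply (Q o\<^sub>L Z o\<^sub>L Q))"
  proof (rule injI)
    fix x y assume "blinfun_apply (Q o\<^sub>L Z o\<^sub>L Q) x = blinfun_apply (Q o\<^sub>L Z o\<^sub>L Q) y"
    then have "blinfun_apply Z (blinfun_apply Q x) = blinfun_apply Z (blinfun_apply Q y)"
      using injD[OF Q_inj] by simp
    then show "x = y" by (rule injD[OF Q_inj injD[OF Z(2)]])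
  qed
  show "0 \<le> inner x (blinfun_apply (Q o\<^sub>L Z o\<^sub>L Q) x)"
    using Z(3) by (simp add: clinear_sym_inner[OF Q_sym, symmetric])
qed

text \<open>With \<open>S\<close> for \<open>H(t)^(-1/2)\<close>, (S2) at \<open>S (S x)\<close> and
  \<open>S (S y)\<close> bounds \<open>B\<close> at \<open>S x\<close> and \<open>S y\<close>, and
  the range of \<open>S\<close> is dense. Such test vectors lie in the operator domain, the range of
  \<open>W\<close>; there membership in \<open>Hplus A\<close> and the value of the square root are
  explicit.\<close>

lemma form_bound_coordinates:
  assumes Z: "clinear_sym Z" "inj (blinfun_apply Z)" "\<And>x. 0 \<le> inner x (blinfun_apply Z x)"
    and norm_Z: "norm Z \<le> c" and "0 \<le> c"
    and bound: "\<And>\<Psi> \<Phi>. \<Psi> \<in> Hplus A \<Longrightarrow> \<Phi> \<in> Hplus A \<Longrightarrow>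
      cmod (cinner (op_app (op_sqrt {(blinfun_apply (Q o\<^sub>L Z o\<^sub>L Q) y, y) | y. True}) \<Psi>)
        (blinfun_apply B (op_app (op_sqrt {(blinfun_apply (Q o\<^sub>L Z o\<^sub>L Q) y, y) | y. True}) \<Phi>)))
      \<le> c * norm \<Psi> * norm \<Phi>"
  shows "\<bar>inner a (blinfun_apply B b)\<bar> \<le> c\<^sup>2 * norm (blinfun_apply Q a) * norm (blinfun_apply Q b)"
proof -
  define W where "W = Q o\<^sub>L Z o\<^sub>L Q"
  obtain S where S: "clinear_sym S" "inj (blinfun_apply S)" "S o\<^sub>L S = W"
    "op_sqrt {(blinfun_apply W x, x) | x. True} = {(blinfun_apply S x, x) | x. True}"
    by (rule op_sqrt_bounded_inverse[OF conjugated_inverse[OF Z], folded W_def]) (rule that)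
  have SS: "blinfun_apply S (blinfun_apply S x) = blinfun_apply W x" for x
    using S(3) by (metis blinfun_apply_blinfun_compose)
  have app: "op_app (op_sqrt {(blinfun_apply W x, x) | x. True}) (blinfun_apply S x) = x" for x
    unfolding op_app_def S(4) by (rule the_equality) (use S(2) in \<open>auto dest: injD\<close>)
  have app_W: "op_app (op_sqrt {(blinfun_apply W x, x) | x. True}) (blinfun_apply W x) = blinfun_apply S x" for x
    using app[of "blinfun_apply S x"] unfolding SS .
  have W_Hplus: "blinfun_apply W x \<in> Hplus A" for x unfolding W_def Hplus_eq by simp
  have ran: "\<bar>inner (blinfun_apply S x) (blinfun_apply B (blinfun_apply S y))\<bar>
      \<le> c * norm (blinfun_apply S (blinfun_apply S x)) * norm (blinfun_apply S (blinfun_apply S y))" for x y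
    unfolding SS using bound[OF W_Hplus[of x] W_Hplus[of y], folded W_def, unfolded app_W]
      abs_Re_le_cmod[of "cinner (blinfun_apply S x) (blinfun_apply B (blinfun_apply S y))"]
    unfolding Re_cinner by linarith
  have "\<bar>inner a (blinfun_apply B b)\<bar> \<le> c * norm (blinfun_apply S a) * norm (blinfun_apply S b)"
  proof -
    obtain f g where fg: "(\<lambda>n. blinfun_apply S (f n)) \<longlonglongrightarrow> a" "(\<lambda>n. blinfun_apply S (g n)) \<longlonglongrightarrow> b"
      using dense_range_sequence[OF dense_range_sym[OF S(1,2)]] by meson
    show ?thesis
    proof (rule LIMSEQ_le)
      show "(\<lambda>n. \<bar>inner (blinfun_apply S (f n)) (blinfun_apply B (blinfun_apply S (g n)))\<bar>)
          \<longlonglongrightarrow> \<bar>inner a (blinfun_apply B b)\<bar>"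
        by (intro tendsto_intros fg)
      show "(\<lambda>n. c * norm (blinfun_apply S (blinfun_apply S (f n))) * norm (blinfun_apply S (blinfun_apply S (g n))))
          \<longlonglongrightarrow> c * norm (blinfun_apply S a) * norm (blinfun_apply S b)"
        by (intro tendsto_intros fg)
    qed (use ran in blast)
  qed
  also have "\<dots> \<le> c * (sqrt c * norm (blinfun_apply Q a)) * (sqrt c * norm (blinfun_apply Q b))"
  proof -
    \<comment> \<open>The squared norm of \<open>S x\<close> is the form of \<open>Z\<close> at
      \<open>Q x\<close>. Each argument thus contributes \<open>sqrt c\<close>, which makes the
      second factor \<open>c\<close> of the constant.\<close>
    have "norm (blinfun_apply S x) \<le> sqrt c * norm (blinfun_apply Q x)" for x
    proof (rule power2_le_imp_le)
      have "(norm (blinfun_apply S x))\<^sup>2 = inner (blinfun_apply Q x) (blinfun_apply Z (blinfun_apply Q x))"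
        by (simp add: power2_norm_eq_inner clinear_sym_inner[OF S(1)] SS W_def clinear_sym_inner[OF Q_sym])
      also have "\<dots> \<le> norm (blinfun_apply Q x) * (norm Z * norm (blinfun_apply Q x))"
        by (rule order_trans[OF norm_cauchy_schwarz mult_left_mono[OF norm_blinfun]]) simp
      also have "\<dots> \<le> norm (blinfun_apply Q x) * (c * norm (blinfun_apply Q x))"
        using norm_Z by (intro mult_left_mono mult_right_mono) auto
      also have "\<dots> = (sqrt c * norm (blinfun_apply Q x))\<^sup>2"
        using \<open>0 \<le> c\<close> by (simp add: power_mult_distrib power2_eq_square)
      finally show "(norm (blinfun_apply S x))\<^sup>2 \<le> (sqrt c * norm (blinfun_apply Q x))\<^sup>2" .
    qed (use \<open>0 \<le> c\<close> in simp)
    then show ?thesis using \<open>0 \<le> c\<close> by (intro mult_mono order_refl) auto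
  qed
  also have "\<dots> = c * (sqrt c * sqrt c) * norm (blinfun_apply Q a) * norm (blinfun_apply Q b)"
    by (simp only: mult_ac)
  also have "\<dots> = c\<^sup>2 * norm (blinfun_apply Q a) * norm (blinfun_apply Q b)"
    using \<open>0 \<le> c\<close> by (simp add: power2_eq_square)
  finally show ?thesis .
qed

lemma csubspace_Hplus: "csubspace (Hplus A)"
  unfolding csubspace_def Hplus_eq
proof (intro conjI ballI allI)
  show "0 \<in> range (blinfun_apply Q)" by (rule range_eqI[of _ _ 0]) (simp add: blinfun.zero_right)
qed (auto simp: blinfun.add_right[symmetric] clinear_sym_scaleC[OF Q_sym, symmetric])

lemma inner_product_on_form:
  assumes L: "clinear_sym L" and c: "0 < c" and below: "\<And>x. c * (norm x)\<^sup>2 \<le> inner x (blinfun_apply L x)"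
    and p: "\<And>x y. p (blinfun_apply Q x) (blinfun_apply Q y) = cinner x (blinfun_apply L y)"
  shows "inner_product_on (Hplus A) p"
proof -
  have "inner_product_on (range (blinfun_apply Q)) p"
    unfolding inner_product_on_def
  proof (intro conjI ballI allI impI; clarsimp simp: p)
    fix x y z a
    show "cinner x (blinfun_apply L y) = cnj (cinner y (blinfun_apply L x))"
      by (metis cinner_commute clinear_sym_cinner[OF L])
    show "p (blinfun_apply Q x) (blinfun_apply Q y + blinfun_apply Q z)
        = cinner x (blinfun_apply L y) + cinner x (blinfun_apply L z)"
      by (simp add: blinfun.add_right[symmetric] p) (simp add: blinfun.add_right cinner_add_right)
    show "p (blinfun_apply Q x) (a *\<^sub>C blinfun_apply Q y) = a * cinner x (blinfun_apply L y)"
      by (simp add: clinear_sym_scaleC[OF Q_sym, symmetric] p)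
        (simp add: clinear_sym_scaleC[OF L] cinner_scaleC_right)
    assume "blinfun_apply Q x \<noteq> 0"
    then have "x \<noteq> 0" using blinfun.zero_right by metis
    then have "0 < c * (norm x)\<^sup>2" using c by simp
    then show "0 < Re (cinner x (blinfun_apply L x))" using below[of x] by (simp add: Re_cinner)
  qed
  then show ?thesis unfolding Hplus_eq .
qed

lemma ip_norm_form_bounds:
  assumes L: "clinear_sym L" and c: "0 < c" and below: "\<And>x. c * (norm x)\<^sup>2 \<le> inner x (blinfun_apply L x)"
    and p: "\<And>x y. p (blinfun_apply Q x) (blinfun_apply Q y) = cinner x (blinfun_apply L y)"
  shows "sqrt c * norm x \<le> ip_norm p (blinfun_apply Q x)"
    and "ip_norm p (blinfun_apply Q x) \<le> sqrt (norm L) * norm x"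
proof -
  have ip: "ip_norm p (blinfun_apply Q x) = sqrt (inner x (blinfun_apply L x))"
    unfolding ip_norm_def p Re_cinner ..
  have "sqrt c * norm x = sqrt (c * (norm x)\<^sup>2)" by (simp add: real_sqrt_mult)
  also have "\<dots> \<le> sqrt (inner x (blinfun_apply L x))" using below by simp
  finally show "sqrt c * norm x \<le> ip_norm p (blinfun_apply Q x)" unfolding ip .
  have "inner x (blinfun_apply L x) \<le> norm x * (norm L * norm x)"
    by (rule order_trans[OF norm_cauchy_schwarz mult_left_mono[OF norm_blinfun]]) simp
  then have "sqrt (inner x (blinfun_apply L x)) \<le> sqrt (norm L * (norm x)\<^sup>2)"
    by (simp add: power2_eq_square mult_ac)
  then show "ip_norm p (blinfun_apply Q x) \<le> sqrt (norm L) * norm x"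
    unfolding ip by (simp add: real_sqrt_mult)
qed

text \<open>At \<open>Q x\<close> the norm of the form is equivalent to \<open>norm x\<close>, so
  Cauchy sequences are handled through their preimages under \<open>Q\<close>. Continuous
  containment adds only the boundedness of \<open>Q\<close>.\<close>

lemma hilbert_on_form:
  assumes L: "clinear_sym L" and c: "0 < c" and below: "\<And>x. c * (norm x)\<^sup>2 \<le> inner x (blinfun_apply L x)"
    and p: "\<And>x y. p (blinfun_apply Q x) (blinfun_apply Q y) = cinner x (blinfun_apply L y)"
  shows "hilbert_on (Hplus A) p" and "continuously_contained (Hplus A) p"
proof -
  note bounds = ip_norm_form_bounds[of L c p, OF L c below p]
  show "hilbert_on (Hplus A) p"
    unfolding hilbert_on_def
  proof (intro conjI csubspace_Hplus inner_product_on_form[of L c p, OF L c below p] allI impI)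
    fix X :: "nat \<Rightarrow> 'h"
    assume "\<forall>n. X n \<in> Hplus A" and X: "\<forall>e>0. \<exists>M. \<forall>m\<ge>M. \<forall>n\<ge>M. ip_norm p (X m - X n) < e"
    then have "\<forall>n. \<exists>x. X n = blinfun_apply Q x" unfolding Hplus_eq by blast
    from choice[OF this] obtain x where x: "\<And>n. X n = blinfun_apply Q (x n)" by blast
    have "Cauchy x"
    proof (rule metric_CauchyI)
      fix e :: real assume "e > 0"
      then have "sqrt c * e > 0" using c by simp
      then obtain N where N: "\<And>m n. m \<ge> N \<Longrightarrow> n \<ge> N \<Longrightarrow> ip_norm p (X m - X n) < sqrt c * e"
        using X by blast
      have "dist (x m) (x n) < e" if "m \<ge> N" "n \<ge> N" for m n
      proof -
        have "sqrt c * norm (x m - x n) < sqrt c * e"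
          using bounds(1)[of "x m - x n"] N[OF that] unfolding x by (simp add: blinfun.diff_right)
        then show ?thesis using c by (simp add: dist_norm)
      qed
      then show "\<exists>N. \<forall>m\<ge>N. \<forall>n\<ge>N. dist (x m) (x n) < e" by blast
    qed
    then obtain l where l: "x \<longlonglongrightarrow> l" using Cauchy_convergent_iff convergent_def by blast
    have "(\<lambda>n. ip_norm p (X n - blinfun_apply Q l)) \<longlonglongrightarrow> 0"
    proof (rule Lim_null_comparison)
      have "norm (ip_norm p (X n - blinfun_apply Q l)) \<le> sqrt (norm L) * norm (x n - l)" for n
      proof -
        have "0 \<le> sqrt c * norm (x n - l)" using c by simp
        then show ?thesis
          using bounds[of "x n - l"] unfolding x blinfun.diff_right[symmetric] by simp
      qed
      then show "eventually (\<lambda>n. norm (ip_norm p (X n - blinfun_apply Q l)) \<le> sqrt (norm L) * norm (x n - l)) sequentially"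
        by simp
      have "(\<lambda>n. sqrt (norm L) * norm (x n - l)) \<longlonglongrightarrow> sqrt (norm L) * norm (l - l)"
        by (intro tendsto_intros l)
      then show "(\<lambda>n. sqrt (norm L) * norm (x n - l)) \<longlonglongrightarrow> 0" by simp
    qed
    then show "\<exists>L\<in>Hplus A. (\<lambda>n. ip_norm p (X n - L)) \<longlonglongrightarrow> 0" unfolding Hplus_eq by blast
  qed
  show "continuously_contained (Hplus A) p"
    unfolding continuously_contained_def
  proof (intro exI ballI)
    fix y assume "y \<in> Hplus A"
    then obtain x where y: "y = blinfun_apply Q x" unfolding Hplus_eq by blast
    have "norm y \<le> norm Q * norm x" unfolding y by (rule norm_blinfun)
    also have "\<dots> \<le> norm Q * (ip_norm p y / sqrt c)"
      using bounds(1)[of x] c unfolding y by (intro mult_left_mono) (simp_all add: field_simps)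
    finally show "norm y \<le> norm Q / sqrt c * ip_norm p y" by simp
  qed
qed

end

theorem theorem3p20:
  fixes T C :: real
    and H0 :: "'h::complex_hilbert unbdd_op"
    and \<iota> :: "'h \<Rightarrow> 'm::complex_hilbert"
    and H :: "real \<Rightarrow> 'h \<Rightarrow> 'm"
    and B :: "real \<Rightarrow> 'h \<Rightarrow>\<^sub>L 'h"
  assumes "T > 0"
    and separable: "separable_space (euclidean :: 'h topology)"
    and H0: "positive_selfadjoint_op H0"
    and completion: "minus_completion H0 \<iota>"
    and bounded: "\<And>t. t \<in> {0..T} \<Longrightarrow> bounded_plus_minus H0 (H t)"
    and symmetric: "\<And>t \<Psi> \<Phi>. t \<in> {0..T} \<Longrightarrow> \<Psi> \<in> Hplus H0 \<Longrightarrow> \<Phi> \<in> Hplus H0 \<Longrightarrow>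
           pair_pm \<iota> \<Psi> (H t \<Phi>) = pair_mp \<iota> (H t \<Psi>) \<Phi>"
    and "C > 0"
    and S1: "\<And>t. t \<in> {0..T} \<Longrightarrow>
           form_le \<iota> H0 (\<lambda>\<Phi>. inverse C *\<^sub>R (op_ext \<iota> H0 \<Phi> + \<iota> \<Phi>)) (H t) \<and>
           form_le \<iota> H0 (H t) (\<lambda>\<Phi>. C *\<^sub>R (op_ext \<iota> H0 \<Phi> + \<iota> \<Phi>))"
    and S2_deriv: "\<And>t. t \<in> {0..T} \<Longrightarrow>
           ((\<lambda>s. op_inverse (restrict_op \<iota> H0 (H s))) has_vector_derivative B t)
             (at t within {0..T})"
    and S2_bound: "\<And>t \<Psi> \<Phi>. t \<in> {0..T} \<Longrightarrow> \<Psi> \<in> Hplus H0 \<Longrightarrow> \<Phi> \<in> Hplus H0 \<Longrightarrow>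
           cmod (cinner (op_app (op_sqrt (restrict_op \<iota> H0 (H t))) \<Psi>)
                   (blinfun_apply (B t) (op_app (op_sqrt (restrict_op \<iota> H0 (H t))) \<Phi>)))
             \<le> C * norm \<Psi> * norm \<Phi>"
    and B_continuous: "continuous_on {0..T} B"
  shows "csubspace (Hplus H0) \<and> closure (Hplus H0) = UNIV \<and>
         (\<forall>t\<in>{0..T}. inner_product_on (Hplus H0) (\<lambda>\<Psi> \<Phi>. pair_pm \<iota> \<Psi> (H t \<Phi>))) \<and>
         (\<forall>t\<in>{0..T}. hilbert_on (Hplus H0) (\<lambda>\<Psi> \<Phi>. pair_pm \<iota> \<Psi> (H t \<Phi>)) \<and>
                      continuously_contained (Hplus H0) (\<lambda>\<Psi> \<Phi>. pair_pm \<iota> \<Psi> (H t \<Phi>))) \<and>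
         (\<forall>\<Psi>\<in>Hplus H0. \<forall>\<Phi>\<in>Hplus H0. C1_on {0..T} (\<lambda>t. pair_pm \<iota> \<Psi> (H t \<Phi>)))"
proof -
  obtain Q U where "scale_coordinates H0 \<iota> Q U"
    using exists_scale_coordinates[OF H0 completion] .
  then interpret scale_coordinates H0 \<iota> Q U .
  have "\<exists>L. clinear_sym L \<and> (\<forall>x. blinfun_apply U (H t (blinfun_apply Q x)) = blinfun_apply L x)"
    if t: "t \<in> {0..T}" for t
    by (rule form_operator[OF bounded[OF t] symmetric[OF t]]) blast+
  then have "\<forall>t\<in>{0..T}. \<exists>L. clinear_sym L \<and>
      (\<forall>x. blinfun_apply U (H t (blinfun_apply Q x)) = blinfun_apply L x)" by blast
  from bchoice[OF this] obtain L where L: "\<And>t. t \<in> {0..T} \<Longrightarrow> clinear_sym (L t)"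
      "\<And>t x. t \<in> {0..T} \<Longrightarrow> blinfun_apply U (H t (blinfun_apply Q x)) = blinfun_apply (L t) x"
    by blast
  have pairing: "pair_pm \<iota> (blinfun_apply Q x) (H t (blinfun_apply Q y)) = cinner x (blinfun_apply (L t) y)"
    if "t \<in> {0..T}" for t x y
    unfolding pair_pm_eq L(2)[OF that] ..
  \<comment> \<open>The form of a multiple of \<open>H0 + 1\<close> is the same multiple of
    \<open>(norm x)\<^sup>2\<close> in coordinates, so the constants of (S1) carry over
    unchanged.\<close>
  have below: "inverse C * (norm x)\<^sup>2 \<le> inner x (blinfun_apply (L t) x)"
    and above: "inner x (blinfun_apply (L t) x) \<le> C * (norm x)\<^sup>2" if t: "t \<in> {0..T}" for t x
  proof -
    have "blinfun_apply Q x \<in> Hplus H0" unfolding Hplus_eq by blast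
    then show "inverse C * (norm x)\<^sup>2 \<le> inner x (blinfun_apply (L t) x)"
      "inner x (blinfun_apply (L t) x) \<le> C * (norm x)\<^sup>2"
      using S1[OF t] unfolding form_le_def form_A_plus_one[symmetric] Re_cinner[symmetric] pairing[OF t, symmetric]
      by blast+
  qed
  have C: "0 < inverse C" using \<open>C > 0\<close> by simp
  have "\<exists>Z. clinear_sym Z \<and> (\<forall>x. blinfun_apply Z (blinfun_apply (L t) x) = x) \<and>
      (\<forall>x. blinfun_apply (L t) (blinfun_apply Z x) = x) \<and> (\<forall>x. 0 \<le> inner x (blinfun_apply Z x)) \<and>
      norm Z \<le> C" if t: "t \<in> {0..T}" for t
    by (rule exists_inverse_sym[OF L(1)[OF t] C below[OF t]]) auto
  then have "\<forall>t\<in>{0..T}. \<exists>Z. clinear_sym Z \<and> (\<forall>x. blinfun_apply Z (blinfun_apply (L t) x) = x) \<and>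
      (\<forall>x. blinfun_apply (L t) (blinfun_apply Z x) = x) \<and> (\<forall>x. 0 \<le> inner x (blinfun_apply Z x)) \<and>
      norm Z \<le> C" by blast
  from bchoice[OF this] obtain Z where Z: "\<And>t. t \<in> {0..T} \<Longrightarrow> clinear_sym (Z t)"
      "\<And>t x. t \<in> {0..T} \<Longrightarrow> blinfun_apply (Z t) (blinfun_apply (L t) x) = x"
      "\<And>t x. t \<in> {0..T} \<Longrightarrow> blinfun_apply (L t) (blinfun_apply (Z t) x) = x"
      "\<And>t x. t \<in> {0..T} \<Longrightarrow> 0 \<le> inner x (blinfun_apply (Z t) x)"
      "\<And>t. t \<in> {0..T} \<Longrightarrow> norm (Z t) \<le> C" by blast
  have Z_inj: "inj (blinfun_apply (Z t))" if "t \<in> {0..T}" for t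
    by (rule inj_on_inverseI[of _ "blinfun_apply (L t)"]) (rule Z(3)[OF that])
  have restrict: "restrict_op \<iota> H0 (H t) = {(blinfun_apply (Q o\<^sub>L Z t o\<^sub>L Q) y, y) | y. True}"
    if "t \<in> {0..T}" for t
    by (rule restrict_op_coordinates[OF L(2)[OF that] Z(3)[OF that] Z(2)[OF that]])
  have "inverse_family Q L Z B T C (C\<^sup>2)"
  proof
    show "0 < T" by fact
    show "0 \<le> C" using \<open>C > 0\<close> by simp
    show "0 \<le> C\<^sup>2" by simp
    show "inner (blinfun_apply Q x) y = inner x (blinfun_apply Q y)" for x y
      by (rule clinear_sym_inner[OF Q_sym])
    show "closure (range (blinfun_apply Q)) = UNIV" by (rule Q_dense)
    show "continuous_on {0..T} B" by fact
    fix t assume t: "t \<in> {0..T}"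
    show "inner (blinfun_apply (L t) x) y = inner x (blinfun_apply (L t) y)" for x y
      by (rule clinear_sym_inner[OF L(1)[OF t]])
    show "blinfun_apply (L t) (blinfun_apply (Z t) x) = x" "blinfun_apply (Z t) (blinfun_apply (L t) x) = x" for x
      using Z(2,3)[OF t] by auto
    show "norm (L t) \<le> C"
    proof (rule norm_symmetric_le[OF clinear_sym_inner[OF L(1)[OF t]]])
      fix x :: 'h
      have "0 \<le> inverse C * (norm x)\<^sup>2" using C by simp
      then show "\<bar>inner x (blinfun_apply (L t) x)\<bar> \<le> C * (norm x)\<^sup>2"
        using below[OF t, of x] above[OF t, of x] by linarith
    qed (use \<open>C > 0\<close> in simp)
    \<comment> \<open>\<open>Z\<close> was chosen on \<open>{0..T}\<close> only, so the two families
      are compared just there; the derivative within that interval sees no other values.\<close>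
    have "op_inverse (restrict_op \<iota> H0 (H s)) = Q o\<^sub>L Z s o\<^sub>L Q" if "s \<in> {0..T}" for s
      unfolding restrict[OF that] by (rule op_inverse_coordinates)
    then show "((\<lambda>s. Q o\<^sub>L Z s o\<^sub>L Q) has_vector_derivative B t) (at t within {0..T})"
      by (intro has_vector_derivative_transform[OF t _ S2_deriv[OF t]]) simp
    show "\<bar>inner a (blinfun_apply (B t) b)\<bar> \<le> C\<^sup>2 * norm (blinfun_apply Q a) * norm (blinfun_apply Q b)" for a b
      by (rule form_bound_coordinates[OF Z(1)[OF t] Z_inj[OF t] Z(4)[OF t] Z(5)[OF t]])
        (use \<open>C > 0\<close> S2_bound[OF t] in \<open>auto simp: restrict[OF t]\<close>)
  qed
  then interpret inverse_family Q L Z B T C "C\<^sup>2" .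
  have C1: "C1_on {0..T} (\<lambda>t. pair_pm \<iota> (blinfun_apply Q x) (H t (blinfun_apply Q y)))" for x y
  proof -
    have "C1_on {0..T} (\<lambda>t. cinner x (blinfun_apply (L t) y))"
      by (rule C1_on_cinner[OF K_weakly_C1]) (rule clinear_sym_scaleC[OF L(1)])
    then obtain f' where f': "continuous_on {0..T} f'" "\<And>t. t \<in> {0..T} \<Longrightarrow>
        ((\<lambda>t. cinner x (blinfun_apply (L t) y)) has_vector_derivative f' t) (at t within {0..T})"
      unfolding C1_on_def by blast
    have "((\<lambda>t. pair_pm \<iota> (blinfun_apply Q x) (H t (blinfun_apply Q y))) has_vector_derivative f' t) (at t within {0..T})"
      if t: "t \<in> {0..T}" for t
      by (rule has_vector_derivative_transform[OF t _ f'(2)[OF t]]) (rule pairing)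
    then show ?thesis unfolding C1_on_def using f'(1) by blast
  qed
  show ?thesis
  proof (intro conjI ballI)
    show "csubspace (Hplus H0)" by (rule csubspace_Hplus)
    show "closure (Hplus H0) = UNIV" unfolding Hplus_eq by (rule Q_dense)
    show "C1_on {0..T} (\<lambda>t. pair_pm \<iota> \<Psi> (H t \<Phi>))" if "\<Psi> \<in> Hplus H0" "\<Phi> \<in> Hplus H0" for \<Psi> \<Phi>
      using that C1 unfolding Hplus_eq by blast
    fix t assume t: "t \<in> {0..T}"
    show "inner_product_on (Hplus H0) (\<lambda>\<Psi> \<Phi>. pair_pm \<iota> \<Psi> (H t \<Phi>))"
      by (rule inner_product_on_form[OF L(1)[OF t] C below[OF t] pairing[OF t]])
    show "hilbert_on (Hplus H0) (\<lambda>\<Psi> \<Phi>. pair_pm \<iota> \<Psi> (H t \<Phi>))"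
      "continuously_contained (Hplus H0) (\<lambda>\<Psi> \<Phi>. pair_pm \<iota> \<Psi> (H t \<Phi>))"
      by (rule hilbert_on_form[OF L(1)[OF t] C below[OF t] pairing[OF t]])+
  qed
qed

end
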